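(* Let $F$ be a finite field of characteristic $p$ with $|F|=q=p^k$ and let $G=C_3 \times D_8$. If $p>3$, then $$U(FG) \cong \begin{cases} C_{p^k-1}^{12} \times GL(2,F)^3, & \text{if } q \equiv 1 \text{ or } -5 \bmod 12;\\ C_{p^k-1}^4 \times C_{p^{2k}-1}^4 \times GL(2, F) \times GL(2, F_2), & \text{if } q \equiv -1 \text{ or } 5 \bmod 12.\end{cases}$$
   Context: $FG$ denotes the group algebra of a finite group $G$ over $F$, and $U(FG)$ its group of units. $C_n$ is the cyclic group of order $n$, $D_n$ is the dihedral group of order $n$ (so $D_8$ has order $8$), and $H^m$ denotes the direct product of $m$ copies of a group $H$. $F_2$ denotes the extension field of $F$ of degree $2$ (so $|F_2|=q^2$). *)

theory Defs
  imports "HOL-Algebra.Algebra" "HOL-Number_Theory.Cong" "Jordan_Normal_Form.Matrix"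
begin

(* The additive order of 1; group.ord is 0 for elements of infinite order, so this
   agrees with the usual convention that the characteristic is then 0. *)
definition ring_characteristic :: "('a, 'm) ring_scheme \<Rightarrow> nat" where
  "ring_characteristic R = group.ord (add_monoid R) \<one>\<^bsub>R\<^esub>"

(* L is an extension field of F of degree n, where F is embedded in L by a ring homomorphism
   (automatically injective), so that the carriers may have different types. *)
definition extension_field_of_degree ::
    "nat \<Rightarrow> ('a, 'm) ring_scheme \<Rightarrow> ('b, 'n) ring_scheme \<Rightarrow> bool" where
  "extension_field_of_degree n F L \<longleftrightarrow>
     field L \<and> (\<exists>h \<in> Ring.ring_hom F L. ring.dimension L n (h ` carrier F) (carrier L))"

(* Group algebra of a FINITE group: the formal sum of the f g * g over all g in G is represented
   by its coefficient function f; the product is convolution. (For infinite G one would have to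
   require finite support.) *)
definition group_algebra ::
    "('a, 'm) ring_scheme \<Rightarrow> ('g, 'n) monoid_scheme \<Rightarrow> ('g \<Rightarrow> 'a) ring" where
  "group_algebra R G =
     \<lparr> carrier = carrier G \<rightarrow>\<^sub>E carrier R,
       monoid.mult = (\<lambda>f f'. \<lambda>x\<in>carrier G.
          \<Oplus>\<^bsub>R\<^esub>y\<in>carrier G. f y \<otimes>\<^bsub>R\<^esub> f' (inv\<^bsub>G\<^esub> y \<otimes>\<^bsub>G\<^esub> x)),
       monoid.one = (\<lambda>x\<in>carrier G. if x = \<one>\<^bsub>G\<^esub> then \<one>\<^bsub>R\<^esub> else \<zero>\<^bsub>R\<^esub>),
       ring.zero = (\<lambda>x\<in>carrier G. \<zero>\<^bsub>R\<^esub>),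
       ring.add = (\<lambda>f f'. \<lambda>x\<in>carrier G. f x \<oplus>\<^bsub>R\<^esub> f' x) \<rparr>"

(* Matrices over a ring given by a record; the library's ring_mat requires the entries to
   form a type-class ring. *)
definition matrix_ring :: "nat \<Rightarrow> ('a, 'm) ring_scheme \<Rightarrow> 'a mat ring" where
  "matrix_ring n R =
     \<lparr> carrier = {A \<in> carrier_mat n n. elements_mat A \<subseteq> carrier R},
       monoid.mult = (\<lambda>A B. mat n n (\<lambda>(i, j).
          \<Oplus>\<^bsub>R\<^esub>k\<in>{..<n}. A $$ (i, k) \<otimes>\<^bsub>R\<^esub> B $$ (k, j))),
       monoid.one = mat n n (\<lambda>(i, j). if i = j then \<one>\<^bsub>R\<^esub> else \<zero>\<^bsub>R\<^esub>),
       ring.zero = mat n n (\<lambda>_. \<zero>\<^bsub>R\<^esub>),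
       ring.add = (\<lambda>A B. mat n n (\<lambda>ij. A $$ ij \<oplus>\<^bsub>R\<^esub> B $$ ij)) \<rparr>"

definition GL :: "nat \<Rightarrow> ('a, 'm) ring_scheme \<Rightarrow> 'a mat monoid" where
  "GL n R = units_of (matrix_ring n R)"

(* Dihedral group of ORDER n (n even), with m = n div 2: the pair (i, e) stands for r^i s^e,
   where r^m = s^2 = 1 and s r s = r^(-1). *)
definition dihedral_group :: "nat \<Rightarrow> (int \<times> bool) monoid" where
  "dihedral_group n =
     \<lparr> carrier = {0..<int (n div 2)} \<times> UNIV,
       monoid.mult = (\<lambda>(i, e) (j, e').
          ((if e then i - j else i + j) mod int (n div 2), e \<noteq> e')),
       monoid.one = (0, False) \<rparr>"

lemma group_dihedral_group:
  assumes "n \<ge> 2"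
  shows "group (dihedral_group n)"
proof -
  define m where "m = int (n div 2)"
  have m: "m > 0" using assms by (simp add: m_def)
  note d = dihedral_group_def m_def[symmetric]
  show ?thesis
  proof (rule groupI)
    fix x y assume "x \<in> carrier (dihedral_group n)" "y \<in> carrier (dihedral_group n)"
    then show "x \<otimes>\<^bsub>dihedral_group n\<^esub> y \<in> carrier (dihedral_group n)"
      using m by (auto simp: d)
  next
    show "\<one>\<^bsub>dihedral_group n\<^esub> \<in> carrier (dihedral_group n)" using m by (auto simp: d)
  next
    fix x y z
    show "x \<otimes>\<^bsub>dihedral_group n\<^esub> y \<otimes>\<^bsub>dihedral_group n\<^esub> z =
          x \<otimes>\<^bsub>dihedral_group n\<^esub> (y \<otimes>\<^bsub>dihedral_group n\<^esub> z)"
      by (cases x; cases y; cases z) (auto simp: d mod_simps algebra_simps)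
  next
    fix x assume "x \<in> carrier (dihedral_group n)"
    then show "\<one>\<^bsub>dihedral_group n\<^esub> \<otimes>\<^bsub>dihedral_group n\<^esub> x = x" by (auto simp: d)
  next
    fix x assume x: "x \<in> carrier (dihedral_group n)"
    obtain i e where [simp]: "x = (i, e)" by (cases x)
    show "\<exists>y\<in>carrier (dihedral_group n). y \<otimes>\<^bsub>dihedral_group n\<^esub> x = \<one>\<^bsub>dihedral_group n\<^esub>"
      using m x by (intro bexI[of _ "(if e then i else (- i) mod m, e)"])
        (auto simp: d mod_simps)
  qed
qed

lemma order_dihedral_group: "even n \<Longrightarrow> Coset.order (dihedral_group n) = n"
  by (simp add: dihedral_group_def Coset.order_def card_cartesian_product card_UNIV_bool)

definition group_power :: "('a, 'm) monoid_scheme \<Rightarrow> nat \<Rightarrow> (nat \<Rightarrow> 'a) monoid" where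
  "group_power H m = product_group {..<m} (\<lambda>_. H)"

end

(* A ring homomorphism h : F -> K and a map u : G -> K that is multiplicative (or the entries of a
   multiplicative matrix-valued map) give the multiplicative map sending f in FG to the sum of all
   h (f x) u(x). For G = C3 x D8 take u(i, d) = w^i c(d), where w is a cube root of unity in K and c is one
   of the four linear characters of D8 or an entry of its two-dimensional representation; all these
   functions c are integer valued. If F contains a primitive cube root of unity, let w run through all
   three roots and K = F; otherwise take w = 1 over F and a primitive w over the quadratic extension.
   Column orthogonality for D8 together with inversion of the transform on C3 (2 and 3 are invertible)
   shows that the resulting map from FG to the product of copies of K and of M2(K) is injective, and both
   sides have q^24 elements. So it is bijective, and a unital multiplicative bijection maps units onto units. *)

theory Submission
  imports Defs "HOL-Decision_Procs.Algebra_Aux"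
begin

section \<open>Multiplicative maps on group algebras\<close>

text \<open>The case distinction is about cube roots of unity: q = 1 or 7 modulo 12 gives 3 | q - 1,
  whereas q = 5 or 11 gives 3 | q + 1. The D8 part looks the same in both cases because its
  representations have integer entries. FG is read as (F C3) D8, so the inversion has two
  independent stages: for each root w the D8 transform determines one element of K for every d in
  D8, and comparing these elements for the chosen roots determines the three coefficients over d. In
  the quadratic case the conjugate root w^2 is left out: 1 and w are independent over F, so a single
  equation in K already carries two coordinates over F, and together with w = 1 this accounts for
  all three. The exponents of q in the targets are 12 + 3 * 4 = 24 and 4 + 2 * 4 + 4 + 2 * 4 = 24.
  Only products and the identity are compared, since units depend on nothing else.\<close>

lemma (in abelian_monoid) finsum_cartesian_product:
  assumes "finite A" "finite B" "f \<in> A \<times> B \<rightarrow> carrier G"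
  shows "finsum G f (A \<times> B) = (\<Oplus>x\<in>A. \<Oplus>y\<in>B. f (x, y))"
  using assms(1,3)
proof (induction A rule: finite_induct)
  case (insert a A)
  have split: "insert a A \<times> B = Pair a ` B \<union> A \<times> B" by auto
  have "finsum G f (insert a A \<times> B) = finsum G f (Pair a ` B) \<oplus> finsum G f (A \<times> B)"
    unfolding split using insert assms(2) by (intro finsum_Un_disjoint) (auto simp: Pi_def)
  also have "finsum G f (Pair a ` B) = (\<Oplus>y\<in>B. f (a, y))"
    using insert by (intro finsum_reindex) (auto simp: Pi_def inj_on_def)
  finally show ?case using insert by (subst finsum_insert) (auto simp: Pi_def)
qed simp

lemma (in abelian_monoid) finsum_swap:
  assumes "finite A" "finite B" "\<And>x y. x \<in> A \<Longrightarrow> y \<in> B \<Longrightarrow> f x y \<in> carrier G"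
  shows "(\<Oplus>x\<in>A. \<Oplus>y\<in>B. f x y) = (\<Oplus>y\<in>B. \<Oplus>x\<in>A. f x y)"
  using assms(1,3)
proof (induction A rule: finite_induct)
  case (insert a A)
  have "(\<Oplus>y\<in>B. \<Oplus>x\<in>insert a A. f x y) = (\<Oplus>y\<in>B. f a y \<oplus> (\<Oplus>x\<in>A. f x y))"
    using insert by (intro finsum_cong' refl) (auto intro!: finsum_closed)
  also have "\<dots> = (\<Oplus>y\<in>B. f a y) \<oplus> (\<Oplus>y\<in>B. \<Oplus>x\<in>A. f x y)"
    using insert by (intro finsum_addf) (auto intro!: finsum_closed)
  finally show ?case using insert by (subst finsum_insert) (auto intro!: finsum_closed)
qed simp

text \<open>The linear extension of \<open>u\<close> from the group to its group algebra, with
  coefficients carried into K by \<open>h\<close>.\<close>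

definition weighted_sum ::
    "('b, 'n) ring_scheme \<Rightarrow> ('a \<Rightarrow> 'b) \<Rightarrow> ('g, 'k) monoid_scheme \<Rightarrow> ('g \<Rightarrow> 'b) \<Rightarrow> ('g \<Rightarrow> 'a) \<Rightarrow> 'b" where
  "weighted_sum K h G u f = (\<Oplus>\<^bsub>K\<^esub>x\<in>carrier G. h (f x) \<otimes>\<^bsub>K\<^esub> u x)"

lemma one_group_algebra:
  "\<one>\<^bsub>group_algebra R G\<^esub> = (\<lambda>x\<in>carrier G. if x = \<one>\<^bsub>G\<^esub> then \<one>\<^bsub>R\<^esub> else \<zero>\<^bsub>R\<^esub>)"
  by (simp add: group_algebra_def)

lemma carrier_group_algebra: "carrier (group_algebra R G) = carrier G \<rightarrow>\<^sub>E carrier R"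
  by (simp add: group_algebra_def)

lemma one_group_algebra_closed:
  "ring R \<Longrightarrow> \<one>\<^bsub>group_algebra R G\<^esub> \<in> carrier (group_algebra R G)"
  by (auto simp: one_group_algebra carrier_group_algebra ring.ring_simprules)

lemma mult_group_algebra_closed:
  assumes "ring R" "group G"
    and "f \<in> carrier (group_algebra R G)" "g \<in> carrier (group_algebra R G)"
  shows "f \<otimes>\<^bsub>group_algebra R G\<^esub> g \<in> carrier (group_algebra R G)"
proof -
  interpret ring R by fact
  interpret G: group G by fact
  show ?thesis
    using assms(3,4) by (auto simp: group_algebra_def intro!: finsum_closed)
qed

text \<open>\<open>h\<close> will be either the identity of the ground field or its embedding into
  the quadratic extension, so one argument covers both kinds of factors.\<close>

locale coefficient_change = ring_hom_cring R K h + G: group G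
  for R (structure) and K (structure) and h and G (structure) +
  assumes finite_G: "finite (carrier G)"
begin

lemma weighted_sum_closed:
  assumes "f \<in> carrier G \<rightarrow> carrier R" "u \<in> carrier G \<rightarrow> carrier K"
  shows "weighted_sum K h G u f \<in> carrier K"
  using assms unfolding weighted_sum_def by (intro S.finsum_closed) (auto simp: Pi_def)

text \<open>Substituting x = y z in the convolution turns it into a free double sum over G. The
  weight \<open>u\<close> is arbitrary, so that single matrix entries, which are in general not
  multiplicative, can be treated too.\<close>

lemma weighted_sum_mult:
  assumes f: "f \<in> carrier (group_algebra R G)" and g: "g \<in> carrier (group_algebra R G)"
    and u: "u \<in> carrier G \<rightarrow> carrier K"
  shows "weighted_sum K h G u (f \<otimes>\<^bsub>group_algebra R G\<^esub> g) =
    (\<Oplus>\<^bsub>K\<^esub>y\<in>carrier G. \<Oplus>\<^bsub>K\<^esub>z\<in>carrier G. h (f y) \<otimes>\<^bsub>K\<^esub> h (g z) \<otimes>\<^bsub>K\<^esub> u (y \<otimes>\<^bsub>G\<^esub> z))"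
proof -
  have fR: "f y \<in> carrier R" and gR: "g y \<in> carrier R" and uK: "u y \<in> carrier K"
    if "y \<in> carrier G" for y
    using f g u that by (auto simp: carrier_group_algebra)
  have "weighted_sum K h G u (f \<otimes>\<^bsub>group_algebra R G\<^esub> g) =
    (\<Oplus>\<^bsub>K\<^esub>x\<in>carrier G. \<Oplus>\<^bsub>K\<^esub>y\<in>carrier G. h (f y) \<otimes>\<^bsub>K\<^esub> h (g (inv\<^bsub>G\<^esub> y \<otimes>\<^bsub>G\<^esub> x)) \<otimes>\<^bsub>K\<^esub> u x)"
    unfolding weighted_sum_def
  proof (intro S.finsum_cong' refl)
    fix x assume x: "x \<in> carrier G"
    have "h ((f \<otimes>\<^bsub>group_algebra R G\<^esub> g) x) =
        (\<Oplus>\<^bsub>K\<^esub>y\<in>carrier G. h (f y) \<otimes>\<^bsub>K\<^esub> h (g (inv\<^bsub>G\<^esub> y \<otimes>\<^bsub>G\<^esub> x)))"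
      using x fR gR
      by (auto simp: group_algebra_def Pi_def intro!: S.finsum_cong')
    then show "h ((f \<otimes>\<^bsub>group_algebra R G\<^esub> g) x) \<otimes>\<^bsub>K\<^esub> u x =
        (\<Oplus>\<^bsub>K\<^esub>y\<in>carrier G. h (f y) \<otimes>\<^bsub>K\<^esub> h (g (inv\<^bsub>G\<^esub> y \<otimes>\<^bsub>G\<^esub> x)) \<otimes>\<^bsub>K\<^esub> u x)"
      using x fR gR uK finite_G by (simp add: S.finsum_ldistr Pi_def)
  qed (use fR gR uK in \<open>auto intro!: S.finsum_closed\<close>)
  also have "\<dots> = (\<Oplus>\<^bsub>K\<^esub>y\<in>carrier G. \<Oplus>\<^bsub>K\<^esub>x\<in>carrier G.
      h (f y) \<otimes>\<^bsub>K\<^esub> h (g (inv\<^bsub>G\<^esub> y \<otimes>\<^bsub>G\<^esub> x)) \<otimes>\<^bsub>K\<^esub> u x)"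
    using fR gR uK finite_G by (intro S.finsum_swap) auto
  also have "\<dots> = (\<Oplus>\<^bsub>K\<^esub>y\<in>carrier G. \<Oplus>\<^bsub>K\<^esub>z\<in>carrier G. h (f y) \<otimes>\<^bsub>K\<^esub> h (g z) \<otimes>\<^bsub>K\<^esub> u (y \<otimes>\<^bsub>G\<^esub> z))"
  proof (rule S.finsum_cong'[OF refl])
    fix y assume y: "y \<in> carrier G"
    \<comment> \<open>Left translation by \<open>y\<close> permutes G, which justifies the
      substitution x = y z.\<close>
    have image: "(\<lambda>z. y \<otimes>\<^bsub>G\<^esub> z) ` carrier G = carrier G"
      using y by (rule G.surj_const_mult)
    have "(\<Oplus>\<^bsub>K\<^esub>x\<in>carrier G. h (f y) \<otimes>\<^bsub>K\<^esub> h (g (inv\<^bsub>G\<^esub> y \<otimes>\<^bsub>G\<^esub> x)) \<otimes>\<^bsub>K\<^esub> u x) =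
      (\<Oplus>\<^bsub>K\<^esub>z\<in>carrier G. h (f y) \<otimes>\<^bsub>K\<^esub> h (g (inv\<^bsub>G\<^esub> y \<otimes>\<^bsub>G\<^esub> (y \<otimes>\<^bsub>G\<^esub> z))) \<otimes>\<^bsub>K\<^esub> u (y \<otimes>\<^bsub>G\<^esub> z))"
      using y fR gR uK
      by (subst (1) image[symmetric], intro S.finsum_reindex) (auto intro!: inj_onI)
    also have "\<dots> =
      (\<Oplus>\<^bsub>K\<^esub>z\<in>carrier G. h (f y) \<otimes>\<^bsub>K\<^esub> h (g z) \<otimes>\<^bsub>K\<^esub> u (y \<otimes>\<^bsub>G\<^esub> z))"
      using y fR gR uK by (intro S.finsum_cong' refl) (auto simp: G.inv_solve_left' simp flip: G.m_assoc)
    finally show "(\<Oplus>\<^bsub>K\<^esub>x\<in>carrier G. h (f y) \<otimes>\<^bsub>K\<^esub> h (g (inv\<^bsub>G\<^esub> y \<otimes>\<^bsub>G\<^esub> x)) \<otimes>\<^bsub>K\<^esub> u x) =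
      (\<Oplus>\<^bsub>K\<^esub>z\<in>carrier G. h (f y) \<otimes>\<^bsub>K\<^esub> h (g z) \<otimes>\<^bsub>K\<^esub> u (y \<otimes>\<^bsub>G\<^esub> z))" .
  qed (use fR gR uK in \<open>auto intro!: S.finsum_closed\<close>)
  finally show ?thesis .
qed

text \<open>Two weights occur because entry (i, j) of a matrix product pairs entry (i, k) with entry
  (k, j).\<close>

lemma weighted_sum_times:
  assumes "f \<in> carrier G \<rightarrow> carrier R" "g \<in> carrier G \<rightarrow> carrier R"
    and "u \<in> carrier G \<rightarrow> carrier K" "v \<in> carrier G \<rightarrow> carrier K"
  shows "weighted_sum K h G u f \<otimes>\<^bsub>K\<^esub> weighted_sum K h G v g =
    (\<Oplus>\<^bsub>K\<^esub>y\<in>carrier G. \<Oplus>\<^bsub>K\<^esub>z\<in>carrier G. h (f y) \<otimes>\<^bsub>K\<^esub> h (g z) \<otimes>\<^bsub>K\<^esub> (u y \<otimes>\<^bsub>K\<^esub> v z))"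
proof -
  have c: "h (f y) \<in> carrier K" "h (g y) \<in> carrier K" "u y \<in> carrier K" "v y \<in> carrier K"
    if "y \<in> carrier G" for y
    using assms that by auto
  have "weighted_sum K h G u f \<otimes>\<^bsub>K\<^esub> weighted_sum K h G v g =
    (\<Oplus>\<^bsub>K\<^esub>y\<in>carrier G. (h (f y) \<otimes>\<^bsub>K\<^esub> u y) \<otimes>\<^bsub>K\<^esub> weighted_sum K h G v g)"
    unfolding weighted_sum_def[of K h G u] using c finite_G
    by (intro S.finsum_ldistr) (auto intro!: weighted_sum_closed assms)
  also have "\<dots> = (\<Oplus>\<^bsub>K\<^esub>y\<in>carrier G. \<Oplus>\<^bsub>K\<^esub>z\<in>carrier G. (h (f y) \<otimes>\<^bsub>K\<^esub> u y) \<otimes>\<^bsub>K\<^esub> (h (g z) \<otimes>\<^bsub>K\<^esub> v z))"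
    unfolding weighted_sum_def using c finite_G
    by (intro S.finsum_cong' refl S.finsum_rdistr) (auto intro!: S.finsum_closed)
  also have "\<dots> = (\<Oplus>\<^bsub>K\<^esub>y\<in>carrier G. \<Oplus>\<^bsub>K\<^esub>z\<in>carrier G. h (f y) \<otimes>\<^bsub>K\<^esub> h (g z) \<otimes>\<^bsub>K\<^esub> (u y \<otimes>\<^bsub>K\<^esub> v z))"
    using c by (intro S.finsum_cong' refl) (auto intro!: S.finsum_closed simp: S.m_ac)
  finally show ?thesis .
qed

lemma weighted_sum_one:
  assumes "u \<in> carrier G \<rightarrow> carrier K"
  shows "weighted_sum K h G u \<one>\<^bsub>group_algebra R G\<^esub> = u \<one>\<^bsub>G\<^esub>"
proof -
  have "weighted_sum K h G u \<one>\<^bsub>group_algebra R G\<^esub> =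
    (\<Oplus>\<^bsub>K\<^esub>x\<in>carrier G. if x = \<one>\<^bsub>G\<^esub> then u x else \<zero>\<^bsub>K\<^esub>)"
    unfolding weighted_sum_def using assms
    by (intro S.finsum_cong' refl) (auto simp: one_group_algebra Pi_def)
  also have "\<dots> = u \<one>\<^bsub>G\<^esub>"
    using assms finite_G by (intro S.add.finprod_singleton_swap) auto
  finally show ?thesis .
qed

lemma weighted_sum_hom:
  assumes "u \<in> hom G K"
  shows "weighted_sum K h G u \<in> hom (group_algebra R G) K"
proof (rule homI)
  have u: "u \<in> carrier G \<rightarrow> carrier K" using assms by (auto simp: hom_def)
  fix f g assume f: "f \<in> carrier (group_algebra R G)" and g: "g \<in> carrier (group_algebra R G)"
  then have fg: "f \<in> carrier G \<rightarrow> carrier R" "g \<in> carrier G \<rightarrow> carrier R"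
    by (auto simp: carrier_group_algebra)
  show "weighted_sum K h G u (f \<otimes>\<^bsub>group_algebra R G\<^esub> g) =
      weighted_sum K h G u f \<otimes>\<^bsub>K\<^esub> weighted_sum K h G u g"
    unfolding weighted_sum_mult[OF f g u] weighted_sum_times[OF fg u u] using fg u
    by (intro S.finsum_cong' refl)
      (auto intro!: S.finsum_closed S.m_closed simp: Group.hom_mult[OF assms] Pi_def)
qed (use assms in \<open>auto simp: carrier_group_algebra hom_def intro!: weighted_sum_closed\<close>)

end

text \<open>The entries of \<open>\<rho>\<close> are multiplicative only jointly. The sum over the
  middle index \<open>k\<close> is therefore moved inside the double sum over G, where it becomes an
  entry of \<open>\<rho>\<close> at the product y z.\<close>

lemma (in coefficient_change) weighted_sum_matrix_hom:
  assumes hom: "\<rho> \<in> hom G (matrix_ring n K)"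
  shows "(\<lambda>f. mat n n (\<lambda>ij. weighted_sum K h G (\<lambda>x. \<rho> x $$ ij) f)) \<in>
    hom (group_algebra R G) (matrix_ring n K)"
proof (rule homI)
  have entry: "(\<lambda>x. \<rho> x $$ (i, j)) \<in> carrier G \<rightarrow> carrier K" if "i < n" "j < n" for i j
  proof (rule funcsetI)
    fix x assume "x \<in> carrier G"
    then have "\<rho> x \<in> carrier (matrix_ring n K)" using hom by (auto simp: hom_def)
    then show "\<rho> x $$ (i, j) \<in> carrier K"
      using elements_matI[of "\<rho> x" n n i j] that by (auto simp: matrix_ring_def)
  qed
  have entry_mult: "\<rho> (x \<otimes>\<^bsub>G\<^esub> y) $$ (i, j) = (\<Oplus>\<^bsub>K\<^esub>k\<in>{..<n}. \<rho> x $$ (i, k) \<otimes>\<^bsub>K\<^esub> \<rho> y $$ (k, j))"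
    if "x \<in> carrier G" "y \<in> carrier G" "i < n" "j < n" for x y i j
    using Group.hom_mult[OF hom that(1,2)] that by (simp add: matrix_ring_def)
  {
    fix f assume "f \<in> carrier (group_algebra R G)"
    then have "f \<in> carrier G \<rightarrow> carrier R" by (auto simp: carrier_group_algebra)
    then show "mat n n (\<lambda>ij. weighted_sum K h G (\<lambda>x. \<rho> x $$ ij) f) \<in> carrier (matrix_ring n K)"
      using weighted_sum_closed[OF _ entry] by (auto simp: matrix_ring_def dest!: elements_matD)
  }
  fix f g assume f: "f \<in> carrier (group_algebra R G)" and g: "g \<in> carrier (group_algebra R G)"
  then have fg: "f \<in> carrier G \<rightarrow> carrier R" "g \<in> carrier G \<rightarrow> carrier R"
    by (auto simp: carrier_group_algebra)
  then have c: "h (f y) \<in> carrier K" "h (g y) \<in> carrier K" if "y \<in> carrier G" for y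
    using that by auto
  have "weighted_sum K h G (\<lambda>x. \<rho> x $$ (i, j)) (f \<otimes>\<^bsub>group_algebra R G\<^esub> g) =
      (\<Oplus>\<^bsub>K\<^esub>k\<in>{..<n}. weighted_sum K h G (\<lambda>x. \<rho> x $$ (i, k)) f \<otimes>\<^bsub>K\<^esub>
        weighted_sum K h G (\<lambda>x. \<rho> x $$ (k, j)) g)"
    if ij: "i < n" "j < n" for i j
  proof -
    have e: "\<rho> x $$ (i, k) \<in> carrier K" "\<rho> x $$ (k, j) \<in> carrier K"
      if "x \<in> carrier G" "k < n" for x k
      using entry ij that by (auto simp: Pi_def)
    have "(\<Oplus>\<^bsub>K\<^esub>k\<in>{..<n}. weighted_sum K h G (\<lambda>x. \<rho> x $$ (i, k)) f \<otimes>\<^bsub>K\<^esub>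
        weighted_sum K h G (\<lambda>x. \<rho> x $$ (k, j)) g) =
      (\<Oplus>\<^bsub>K\<^esub>k\<in>{..<n}. \<Oplus>\<^bsub>K\<^esub>y\<in>carrier G. \<Oplus>\<^bsub>K\<^esub>z\<in>carrier G.
        h (f y) \<otimes>\<^bsub>K\<^esub> h (g z) \<otimes>\<^bsub>K\<^esub> (\<rho> y $$ (i, k) \<otimes>\<^bsub>K\<^esub> \<rho> z $$ (k, j)))"
      using c e ij fg by (intro S.finsum_cong' refl weighted_sum_times)
        (auto intro!: S.finsum_closed entry)
    also have "\<dots> = (\<Oplus>\<^bsub>K\<^esub>y\<in>carrier G. \<Oplus>\<^bsub>K\<^esub>k\<in>{..<n}. \<Oplus>\<^bsub>K\<^esub>z\<in>carrier G.
        h (f y) \<otimes>\<^bsub>K\<^esub> h (g z) \<otimes>\<^bsub>K\<^esub> (\<rho> y $$ (i, k) \<otimes>\<^bsub>K\<^esub> \<rho> z $$ (k, j)))"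
      using c e finite_G by (intro S.finsum_swap) (auto intro!: S.finsum_closed)
    also have "\<dots> = (\<Oplus>\<^bsub>K\<^esub>y\<in>carrier G. \<Oplus>\<^bsub>K\<^esub>z\<in>carrier G. \<Oplus>\<^bsub>K\<^esub>k\<in>{..<n}.
        h (f y) \<otimes>\<^bsub>K\<^esub> h (g z) \<otimes>\<^bsub>K\<^esub> (\<rho> y $$ (i, k) \<otimes>\<^bsub>K\<^esub> \<rho> z $$ (k, j)))"
      using c e finite_G by (intro S.finsum_cong'[OF refl] S.finsum_swap) (auto intro!: S.finsum_closed)
    also have "\<dots> = (\<Oplus>\<^bsub>K\<^esub>y\<in>carrier G. \<Oplus>\<^bsub>K\<^esub>z\<in>carrier G.
        h (f y) \<otimes>\<^bsub>K\<^esub> h (g z) \<otimes>\<^bsub>K\<^esub> \<rho> (y \<otimes>\<^bsub>G\<^esub> z) $$ (i, j))"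
    proof (intro S.finsum_cong' refl)
      fix y z assume yz: "y \<in> carrier G" "z \<in> carrier G"
      show "(\<Oplus>\<^bsub>K\<^esub>k\<in>{..<n}. h (f y) \<otimes>\<^bsub>K\<^esub> h (g z) \<otimes>\<^bsub>K\<^esub> (\<rho> y $$ (i, k) \<otimes>\<^bsub>K\<^esub> \<rho> z $$ (k, j))) =
          h (f y) \<otimes>\<^bsub>K\<^esub> h (g z) \<otimes>\<^bsub>K\<^esub> \<rho> (y \<otimes>\<^bsub>G\<^esub> z) $$ (i, j)"
        unfolding entry_mult[OF yz ij] using c e yz
        by (intro S.finsum_rdistr[symmetric]) auto
    qed (use c entry[OF ij] in \<open>auto intro!: S.finsum_closed S.m_closed simp: Pi_def\<close>)
    finally show ?thesis
      unfolding weighted_sum_mult[OF f g entry[OF ij]] ..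
  qed
  then show "mat n n (\<lambda>ij. weighted_sum K h G (\<lambda>x. \<rho> x $$ ij) (f \<otimes>\<^bsub>group_algebra R G\<^esub> g)) =
      mat n n (\<lambda>ij. weighted_sum K h G (\<lambda>x. \<rho> x $$ ij) f) \<otimes>\<^bsub>matrix_ring n K\<^esub>
      mat n n (\<lambda>ij. weighted_sum K h G (\<lambda>x. \<rho> x $$ ij) g)"
    using weighted_sum_closed[OF fg(1) entry] weighted_sum_closed[OF fg(2) entry]
    by (intro eq_matI) (auto simp: matrix_ring_def intro!: S.finsum_cong')
qed

text \<open>An upper bound is the useful direction: an injection into a finite set that is at most
  as large as its source is bijective.\<close>

lemma finite_carrier_matrix_ring:
  assumes "finite (carrier R)"
  shows "finite (carrier (matrix_ring n R))"
    and "card (carrier (matrix_ring n R)) \<le> card (carrier R) ^ (n * n)"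
proof -
  let ?E = "{..<n} \<times> {..<n} \<rightarrow>\<^sub>E carrier R"
  have "carrier (matrix_ring n R) \<subseteq> mat n n ` ?E"
  proof
    fix A assume A: "A \<in> carrier (matrix_ring n R)"
    then have "A = mat n n (\<lambda>ij\<in>{..<n} \<times> {..<n}. A $$ ij)"
      by (intro eq_matI) (auto simp: matrix_ring_def)
    moreover have "(\<lambda>ij\<in>{..<n} \<times> {..<n}. A $$ ij) \<in> ?E"
      using A elements_matI[of A n n] by (auto simp: matrix_ring_def subset_iff)
    ultimately show "A \<in> mat n n ` ?E" by blast
  qed
  moreover have "finite ?E" using assms by (intro finite_PiE) auto
  ultimately show "finite (carrier (matrix_ring n R))"
    and "card (carrier (matrix_ring n R)) \<le> card (carrier R) ^ (n * n)"
    using finite_subset[OF _ finite_imageI] surj_card_le[of ?E "carrier (matrix_ring n R)" "mat n n"]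
    by (auto simp: card_PiE card_cartesian_product)
qed

section \<open>Unit groups, products and finite fields\<close>

text \<open>Being a two-sided inverse is a statement about products and the identity, and the
  bijection preserves and reflects it. Bare multiplicative records suffice, so this applies to the
  group algebra and the matrix ring directly from their definitions.\<close>

lemma is_iso_units_ofI:
  assumes iso: "h \<in> iso M N" and one: "\<one>\<^bsub>M\<^esub> \<in> carrier M" "h \<one>\<^bsub>M\<^esub> = \<one>\<^bsub>N\<^esub>"
    and closed: "\<And>x y. x \<in> carrier M \<Longrightarrow> y \<in> carrier M \<Longrightarrow> x \<otimes>\<^bsub>M\<^esub> y \<in> carrier M"
  shows "units_of M \<cong> units_of N"
proof -
  have hom: "h \<in> hom M N" and bij: "bij_betw h (carrier M) (carrier N)"
    using iso by (auto simp: iso_def)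
  have one_iff: "x \<otimes>\<^bsub>M\<^esub> y = \<one>\<^bsub>M\<^esub> \<longleftrightarrow> h x \<otimes>\<^bsub>N\<^esub> h y = \<one>\<^bsub>N\<^esub>"
    if "x \<in> carrier M" "y \<in> carrier M" for x y
    using inj_on_eq_iff[OF bij_betw_imp_inj_on[OF bij], of "x \<otimes>\<^bsub>M\<^esub> y" "\<one>\<^bsub>M\<^esub>"] that one closed
    by (simp add: hom_mult[OF hom])
  have Units_iff: "h x \<in> Units N \<longleftrightarrow> x \<in> Units M" if x: "x \<in> carrier M" for x
  proof -
    have "h x \<in> Units N \<longleftrightarrow> (\<exists>y\<in>h ` carrier M. y \<otimes>\<^bsub>N\<^esub> h x = \<one>\<^bsub>N\<^esub> \<and> h x \<otimes>\<^bsub>N\<^esub> y = \<one>\<^bsub>N\<^esub>)"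
      using bij x by (auto simp: Units_def bij_betw_def)
    also have "\<dots> \<longleftrightarrow> x \<in> Units M"
      using x by (auto simp: Units_def one_iff)
    finally show ?thesis .
  qed
  have Units_subset: "Units M \<subseteq> carrier M" "Units N \<subseteq> carrier N" by (auto simp: Units_def)
  have "h ` Units M = Units N"
  proof
    show "h ` Units M \<subseteq> Units N" using Units_iff Units_subset by auto
    show "Units N \<subseteq> h ` Units M"
    proof
      fix y assume y: "y \<in> Units N"
      then have "y \<in> h ` carrier M"
        using bij Units_subset by (auto simp: bij_betw_def)
      then obtain x where "x \<in> carrier M" "y = h x" by blast
      then show "y \<in> h ` Units M" using y Units_iff by auto
    qed
  qed
  then have "bij_betw h (Units M) (Units N)"
    using bij_betw_subset[OF bij Units_subset(1)] by blast
  moreover have "h \<in> hom (units_of M) (units_of N)"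
    using Units_iff Units_subset hom by (auto simp: hom_def units_of_def subset_iff)
  ultimately have "h \<in> iso (units_of M) (units_of N)"
    by (simp add: iso_def units_of_carrier)
  then show ?thesis by (rule is_isoI)
qed

lemma units_of_DirProd: "units_of (M \<times>\<times> N) = units_of M \<times>\<times> units_of N"
  by (auto simp: units_of_def DirProd_def Units_def)

lemma Units_product_group: "Units (product_group I M) = (\<Pi>\<^sub>E i\<in>I. Units (M i))"
proof
  show "Units (product_group I M) \<subseteq> (\<Pi>\<^sub>E i\<in>I. Units (M i))"
  proof
    fix x assume "x \<in> Units (product_group I M)"
    then obtain y where x: "x \<in> (\<Pi>\<^sub>E i\<in>I. carrier (M i))" and y: "y \<in> (\<Pi>\<^sub>E i\<in>I. carrier (M i))"
      and yx: "(\<lambda>i\<in>I. y i \<otimes>\<^bsub>M i\<^esub> x i) = (\<lambda>i\<in>I. \<one>\<^bsub>M i\<^esub>)"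
        "(\<lambda>i\<in>I. x i \<otimes>\<^bsub>M i\<^esub> y i) = (\<lambda>i\<in>I. \<one>\<^bsub>M i\<^esub>)"
      by (auto simp: Units_def)
    have "y i \<otimes>\<^bsub>M i\<^esub> x i = \<one>\<^bsub>M i\<^esub>" "x i \<otimes>\<^bsub>M i\<^esub> y i = \<one>\<^bsub>M i\<^esub>" if "i \<in> I" for i
      using fun_cong[OF yx(1), of i] fun_cong[OF yx(2), of i] that by simp_all
    then show "x \<in> (\<Pi>\<^sub>E i\<in>I. Units (M i))"
      using x y unfolding Units_def PiE_iff by blast
  qed
  show "(\<Pi>\<^sub>E i\<in>I. Units (M i)) \<subseteq> Units (product_group I M)"
  proof
    fix x assume x: "x \<in> (\<Pi>\<^sub>E i\<in>I. Units (M i))"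
    then have "\<forall>i\<in>I. \<exists>y. y \<in> carrier (M i) \<and> y \<otimes>\<^bsub>M i\<^esub> x i = \<one>\<^bsub>M i\<^esub> \<and> x i \<otimes>\<^bsub>M i\<^esub> y = \<one>\<^bsub>M i\<^esub>"
      by (auto simp: Units_def PiE_iff)
    then obtain y where "\<forall>i\<in>I. y i \<in> carrier (M i) \<and> y i \<otimes>\<^bsub>M i\<^esub> x i = \<one>\<^bsub>M i\<^esub> \<and> x i \<otimes>\<^bsub>M i\<^esub> y i = \<one>\<^bsub>M i\<^esub>"
      by metis
    then have "restrict y I \<in> (\<Pi>\<^sub>E i\<in>I. carrier (M i))"
      "(\<lambda>i\<in>I. restrict y I i \<otimes>\<^bsub>M i\<^esub> x i) = (\<lambda>i\<in>I. \<one>\<^bsub>M i\<^esub>)"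
      "(\<lambda>i\<in>I. x i \<otimes>\<^bsub>M i\<^esub> restrict y I i) = (\<lambda>i\<in>I. \<one>\<^bsub>M i\<^esub>)"
      by (auto intro!: restrict_ext)
    moreover have "x \<in> (\<Pi>\<^sub>E i\<in>I. carrier (M i))"
      using x by (auto simp: Units_def PiE_iff)
    ultimately show "x \<in> Units (product_group I M)"
      unfolding Units_def carrier_product_group mult_product_group one_product_group by blast
  qed
qed

lemma units_of_group_power: "units_of (group_power M n) = group_power (units_of M) n"
  unfolding group_power_def units_of_def Units_product_group by (simp add: product_group_def)

lemma is_iso_DirProd:
  assumes "G \<cong> G'" "H \<cong> H'"
  shows "G \<times>\<times> H \<cong> G' \<times>\<times> H'"
proof -
  obtain g h where "g \<in> iso G G'" "h \<in> iso H H'"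
    using assms by (auto simp: is_iso_def)
  then have "map_prod g h \<in> iso (G \<times>\<times> H) (G' \<times>\<times> H')"
    by (auto simp: iso_def hom_def Pi_iff bij_betw_map_prod intro!: bij_betw_map_prod)
  then show ?thesis by (rule is_isoI)
qed

lemma is_iso_group_power:
  assumes "G \<cong> H" "group G" "group H"
  shows "group_power G n \<cong> group_power H n"
  using assms unfolding group_power_def by (intro iso_product_groupI) auto

section \<open>Cyclic groups and the multiplicative group of a finite field\<close>

text \<open>Exponents can be reduced modulo the group order, so the powers with smaller exponents
  exhaust G; a surjection between finite sets of equal size is injective. The map goes from residues
  to G and is inverted at the end.\<close>

lemma (in group) integer_mod_group_iso:
  assumes fin: "finite (carrier G)" and a: "a \<in> carrier G"
    and gen: "carrier G = {a [^] i | i :: nat. i \<in> UNIV}"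
  shows "G \<cong> integer_mod_group (order G)"
proof -
  have pos: "order G > 0" using fin order_gt_0_iff_finite by blast
  have pow_mod: "a [^] (i mod order G) = a [^] i" for i :: nat
    using a by (metis pow_order_eq_1 mod_mult_div_eq nat_pow_mult nat_pow_pow nat_pow_one
        nat_pow_closed r_one)
  let ?h = "\<lambda>k::int. a [^] nat k"
  have "?h \<in> hom (integer_mod_group (order G)) G"
  proof (rule homI)
    fix x y assume "x \<in> carrier (integer_mod_group (order G))"
      "y \<in> carrier (integer_mod_group (order G))"
    then have "0 \<le> x" "0 \<le> y" using pos by (auto simp: carrier_integer_mod_group)
    then show "?h (x \<otimes>\<^bsub>integer_mod_group (order G)\<^esub> y) = ?h x \<otimes> ?h y"
      using a by (simp add: nat_mod_distrib nat_add_distrib pow_mod del: pow_nat flip: nat_pow_mult)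
  qed (use a in auto)
  moreover have "?h ` {0..<int (order G)} = carrier G"
  proof
    show "carrier G \<subseteq> ?h ` {0..<int (order G)}"
    proof
      fix x assume "x \<in> carrier G"
      then obtain i :: nat where "x = a [^] i" using gen by auto
      then have "x = ?h (int (i mod order G))" by (simp only: nat_int pow_mod)
      then show "x \<in> ?h ` {0..<int (order G)}" using pos by (intro image_eqI[where x = "int (i mod order G)"]) simp_all
    qed
  qed (use a in auto)
  moreover from this have "inj_on ?h {0..<int (order G)}"
    by (intro eq_card_imp_inj_on) (auto simp: order_def)
  ultimately have "?h \<in> iso (integer_mod_group (order G)) G"
    using pos by (simp add: iso_def bij_betw_def carrier_integer_mod_group)
  then show ?thesis
    using group.iso_sym[OF group_integer_mod_group] is_isoI by blast
qed

lemma (in field) exists_primitive_element: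
  assumes "finite (carrier R)"
  shows "\<exists>a\<in>Units R. Units R = {a [^] i | i :: nat. i \<in> UNIV}"
  using finite_field_mult_group_has_gen[OF assms] field_Units by simp

lemma (in field) card_Units:
  "finite (carrier R) \<Longrightarrow> card (Units R) = card (carrier R) - 1"
  by (simp add: field_Units)

lemma (in field) units_of_iso_integer_mod_group:
  assumes "finite (carrier R)"
  shows "units_of R \<cong> integer_mod_group (card (carrier R) - 1)"
proof -
  interpret U: group "units_of R" by (rule units_group)
  obtain a where a: "a \<in> Units R" "Units R = {a [^] i | i :: nat. i \<in> UNIV}"
    using exists_primitive_element[OF assms] by auto
  then have "carrier (units_of R) = {a [^]\<^bsub>units_of R\<^esub> i | i :: nat. i \<in> UNIV}"
    by (simp add: units_of_carrier units_of_pow)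
  moreover have "finite (carrier (units_of R))" "order (units_of R) = card (carrier R) - 1"
    using assms card_Units by (simp_all add: units_of_carrier order_def field_Units)
  ultimately show ?thesis
    using U.integer_mod_group_iso[of a] a(1) by (simp add: units_of_carrier)
qed

text \<open>A generator of the unit group, raised to one third of its order, has order 3; as 3 is
  prime, differing from 1 is all that primitivity requires.\<close>

lemma (in field) exists_primitive_cube_root:
  assumes fin: "finite (carrier R)" and dvd: "3 dvd card (carrier R) - 1"
  shows "\<exists>w\<in>carrier R. w \<noteq> \<one> \<and> w [^] (3::nat) = \<one>"
proof -
  obtain a where a: "a \<in> Units R" and gen: "Units R = {a [^] i | i :: nat. i \<in> UNIV}"
    using exists_primitive_element[OF fin] by auto
  have aR: "a \<in> carrier R" using a by (rule Units_closed)
  obtain d where d: "card (Units R) = 3 * d" using dvd card_Units[OF fin] by auto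
  have finU: "finite (Units R)" using fin by (simp add: field_Units)
  then have "d > 0" using d a card_gt_0_iff[of "Units R"] by auto
  have "a [^] d \<noteq> \<one>"
  proof
    \<comment> \<open>Then the generator would have at most \<open>d\<close> distinct powers, but
      there are 3 d > d units.\<close>
    assume ad: "a [^] d = \<one>"
    have "a [^] i = a [^] (i mod d)" for i :: nat
      using aR ad by (metis mod_mult_div_eq nat_pow_mult nat_pow_pow nat_pow_one
          nat_pow_closed r_one)
    moreover have "i mod d \<in> {..<d}" for i using \<open>d > 0\<close> by simp
    ultimately have "Units R \<subseteq> (\<lambda>i. a [^] i) ` {..<d}"
      unfolding gen by blast
    then have "card (Units R) \<le> d"
      using surj_card_le[of "{..<d}"] by simp
    then show False using d \<open>d > 0\<close> by simp
  qed
  moreover have "(a [^] d) [^] (3::nat) = \<one>"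
    using units_power_order_eq_one[OF finU a] d aR by (simp add: nat_pow_pow mult.commute)
  ultimately show ?thesis using aR by auto
qed

text \<open>Each step of the dimension adds a vector \<open>v\<close> outside \<open>E\<close>, and
  every element of the enlarged space is k v + e for exactly one pair (k, e). This gives the order
  q^2 of the quadratic extension.\<close>

lemma (in ring) card_dimension:
  assumes "subfield K R" and "dimension n K E"
  shows "card E = card K ^ n"
  using assms(2,1)
proof (induction rule: dimension.induct)
  case (Suc_dim v E n K)
  note K = Suc_dim.prems
  note KR = subfieldE(3)[OF K] and K_sub = subringE[OF subfieldE(1)[OF K]]
  \<comment> \<open>Writing \<open>E\<close> as a span makes its closure under addition, negation
    and scalars available.\<close>
  obtain Vs where "set Vs \<subseteq> carrier R" "Span K Vs = E"
    using exists_base[OF K Suc_dim(3)] by auto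
  note E = Span_subgroup_props[OF K this(1), unfolded this(2)]
  have inj: "k = k' \<and> e = e'"
    if "k \<in> K" "k' \<in> K" "e \<in> E" "e' \<in> E" and eq: "k \<otimes> v \<oplus> e = k' \<otimes> v \<oplus> e'" for k k' e e'
  proof -
    have R: "k \<in> carrier R" "k' \<in> carrier R" "e \<in> carrier R" "e' \<in> carrier R"
      using that KR E(1) by auto
    have "(k \<ominus> k') \<otimes> v = (k \<otimes> v \<oplus> e) \<ominus> (k' \<otimes> v \<oplus> e)"
      using R Suc_dim(1) by algebra
    also have "\<dots> = e' \<oplus> \<ominus> e"
      using R Suc_dim(1) unfolding eq by algebra
    finally have "(k \<ominus> k') \<otimes> v \<in> E"
      using that E by simp
    moreover have "k \<ominus> k' \<in> K" using that K_sub by (simp add: a_minus_def)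
    ultimately have "k \<ominus> k' = \<zero>"
      \<comment> \<open>If k - k' were nonzero, dividing by it would put \<open>v\<close> into
        \<open>E\<close>.\<close>
      using Span_m_inv_simprule[OF K \<open>set Vs \<subseteq> carrier R\<close>, of "k \<ominus> k'" v]
        \<open>Span K Vs = E\<close> Suc_dim(1,2) by auto
    then have "k = k'" using R by simp
    then show ?thesis using R Suc_dim(1) eq by simp
  qed
  have "line_extension K v E = (\<lambda>(k, e). k \<otimes> v \<oplus> e) ` (K \<times> E)"
    by (auto simp: line_extension_mem_iff) blast
  moreover have "inj_on (\<lambda>(k, e). k \<otimes> v \<oplus> e) (K \<times> E)"
    by (intro inj_onI) (auto dest: inj)
  ultimately show ?case
    by (simp add: card_image card_cartesian_product Suc_dim.IH[OF K])
qed simp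

section \<open>The representations of the dihedral group of order 8\<close>

text \<open>For n < 4, the linear character with value (-1)^(n mod 2) on the rotation r and (-1)^(n div 2) on the
  reflection s.\<close>

definition d8_char :: "nat \<Rightarrow> int \<times> bool \<Rightarrow> int" where
  "d8_char n = (\<lambda>(j, e). (if odd n \<and> odd j then -1 else 1) * (if n \<ge> 2 \<and> e then -1 else 1))"

text \<open>The (a, b) entry of the representation that sends r to the rotation by a right angle and s to
  diag(1, -1), so that c and s below are the cosine and sine of j right angles.\<close>

definition d8_rep :: "nat \<Rightarrow> nat \<Rightarrow> int \<times> bool \<Rightarrow> int" where
  "d8_rep a b = (\<lambda>(j, e).
    let c = (if j = 0 then 1 else if j = 2 then -1 else 0);
        s = (if j = 1 then 1 else if j = 3 then -1 else 0)
    in (if a = 0 then (if b = 0 then c else - s) else (if b = 0 then s else c)) *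
       (if b \<noteq> 0 \<and> e then -1 else 1))"

abbreviation "D8 \<equiv> dihedral_group 8"

lemma carrier_D8: "carrier D8 = {0, 1, 2, 3} \<times> UNIV"
  by (auto simp: dihedral_group_def)

lemma d8_char_one [simp]: "d8_char n \<one>\<^bsub>D8\<^esub> = 1"
  by (simp add: d8_char_def dihedral_group_def)

lemma mult_D8:
  "(i, e) \<otimes>\<^bsub>D8\<^esub> (j, e') = ((if e then i - j else i + j) mod 4, e \<noteq> e')"
  by (simp add: dihedral_group_def)

text \<open>A character sees only the parity of the rotation exponent: i - j and i + j have the same
  parity, and reduction modulo the even number 4 preserves it.\<close>

lemma d8_char_mult: "d8_char n (x \<otimes>\<^bsub>D8\<^esub> y) = d8_char n x * d8_char n y"
proof -
  have "odd (i mod 4) \<longleftrightarrow> odd i" for i :: int by presburger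
  then show ?thesis by (cases x; cases y) (simp add: mult_D8 d8_char_def)
qed

lemma d8_rep_one: "a < 2 \<Longrightarrow> b < 2 \<Longrightarrow> d8_rep a b \<one>\<^bsub>D8\<^esub> = (if a = b then 1 else 0)"
  by (auto simp: d8_rep_def dihedral_group_def less_2_cases_iff)

lemma d8_rep_mult:
  assumes "x \<in> carrier D8" "y \<in> carrier D8" "a < 2" "b < 2"
  shows "d8_rep a b (x \<otimes>\<^bsub>D8\<^esub> y) = (\<Sum>k<2. d8_rep a k x * d8_rep k b y)"
proof -
  \<comment> \<open>A finite check of 8 * 8 pairs of group elements and 4 matrix positions;
    quantifying over explicit lists makes it executable.\<close>
  have all: "\<forall>i\<in>set [0, 1, 2, 3]. \<forall>e\<in>set [False, True]. \<forall>j\<in>set [0, 1, 2, 3]. \<forall>e'\<in>set [False, True].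
    \<forall>a\<in>set [0, 1]. \<forall>b\<in>set [0, 1]. d8_rep a b ((if e then i - j else i + j) mod 4, e \<noteq> e') =
      d8_rep a 0 (i, e) * d8_rep 0 b (j, e') + d8_rep a 1 (i, e) * d8_rep 1 b (j, e')"
    by code_simp
  obtain i e j e' where xy: "x = (i, e)" "y = (j, e')"
    by (cases x; cases y)
  have "i \<in> set [0, 1, 2, 3]" "j \<in> set [0, 1, 2, 3]" "a \<in> set [0, 1]" "b \<in> set [0, 1]"
    "e \<in> set [False, True]" "e' \<in> set [False, True]"
    using assms xy by (auto simp: carrier_D8)
  then have "d8_rep a b (x \<otimes>\<^bsub>D8\<^esub> y) = d8_rep a 0 x * d8_rep 0 b y + d8_rep a 1 x * d8_rep 1 b y"
    unfolding xy mult_D8 by (intro all[rule_format])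
  then show ?thesis by (simp add: numeral_2_eq_2)
qed

text \<open>The left-hand side is the value of the regular character at the quotient of x and y: the
  representation is orthogonal of degree 2, which explains the factor 2.\<close>

lemma d8_column_orthogonality:
  assumes "x \<in> carrier D8" "y \<in> carrier D8"
  shows "(\<Sum>n<4. d8_char n x * d8_char n y) + 2 * (\<Sum>a<2. \<Sum>b<2. d8_rep a b x *
    d8_rep a b y) = (if y = x then 8 else 0)"
proof -
  have all: "\<forall>i\<in>set [0, 1, 2, 3]. \<forall>e\<in>set [False, True]. \<forall>j\<in>set [0, 1, 2, 3]. \<forall>e'\<in>set [False, True].
    (\<Sum>n\<leftarrow>[0..<4]. d8_char n (i, e) * d8_char n (j, e')) +
      2 * (\<Sum>a\<leftarrow>[0..<2]. \<Sum>b\<leftarrow>[0..<2]. d8_rep a b (i, e) * d8_rep a b (j, e')) =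
    (if (j, e') = (i, e) then 8 else 0)"
    by code_simp
  obtain i e j e' where xy: "x = (i, e)" "y = (j, e')"
    by (cases x; cases y)
  have "i \<in> set [0, 1, 2, 3]" "j \<in> set [0, 1, 2, 3]"
    "e \<in> set [False, True]" "e' \<in> set [False, True]"
    using assms xy by (auto simp: carrier_D8)
  then have "(\<Sum>n\<leftarrow>[0..<4]. d8_char n x * d8_char n y) +
      2 * (\<Sum>a\<leftarrow>[0..<2]. \<Sum>b\<leftarrow>[0..<2]. d8_rep a b x * d8_rep a b y) =
    (if y = x then 8 else 0)"
    unfolding xy by (intro all[rule_format])
  then show ?thesis
    by (simp only: interv_sum_list_conv_sum_set_nat set_upt atLeast_upt[symmetric] lessThan_atLeast0)
qed

section \<open>Injectivity of the transforms\<close>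

lemma (in ring) of_int_sum: "\<guillemotleft>\<Sum>j\<in>J. c j\<guillemotright> = (\<Oplus>j\<in>J. \<guillemotleft>c j\<guillemotright>)"
  by (induction J rule: infinite_finite_induct) (auto simp: Pi_def)

text \<open>After interchanging the sums, the inner sum over \<open>j\<close> is the orthogonality
  relation, which holds in the integers and hence in every commutative ring. The separate weights
  \<open>e\<close> make room for the degree factor of a matrix representation.\<close>

lemma (in cring) finsum_column_orthogonality:
  assumes "finite D" "finite J" "F \<in> D \<rightarrow> carrier R" "d \<in> D"
    and orth: "\<And>x. x \<in> D \<Longrightarrow> (\<Sum>j\<in>J. e j * c j x) = (if x = d then N else 0)"
  shows "(\<Oplus>j\<in>J. \<guillemotleft>e j\<guillemotright> \<otimes> (\<Oplus>x\<in>D. F x \<otimes> \<guillemotleft>c j x\<guillemotright>)) = F d \<otimes> \<guillemotleft>N\<guillemotright>"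
proof -
  have F: "F x \<in> carrier R" if "x \<in> D" for x using assms(3) that by auto
  have "(\<Oplus>j\<in>J. \<guillemotleft>e j\<guillemotright> \<otimes> (\<Oplus>x\<in>D. F x \<otimes> \<guillemotleft>c j x\<guillemotright>)) =
    (\<Oplus>j\<in>J. \<Oplus>x\<in>D. F x \<otimes> \<guillemotleft>e j * c j x\<guillemotright>)"
  proof (intro finsum_cong'[OF refl])
    fix j
    have "\<guillemotleft>e j\<guillemotright> \<otimes> (\<Oplus>x\<in>D. F x \<otimes> \<guillemotleft>c j x\<guillemotright>) = (\<Oplus>x\<in>D. \<guillemotleft>e j\<guillemotright> \<otimes> (F x \<otimes> \<guillemotleft>c j x\<guillemotright>))"
      using F assms(1) by (intro finsum_rdistr) auto
    also have "\<dots> = (\<Oplus>x\<in>D. F x \<otimes> \<guillemotleft>e j * c j x\<guillemotright>)"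
      using F by (intro finsum_cong'[OF refl]) (auto simp: m_lcomm)
    finally show "\<guillemotleft>e j\<guillemotright> \<otimes> (\<Oplus>x\<in>D. F x \<otimes> \<guillemotleft>c j x\<guillemotright>) = (\<Oplus>x\<in>D. F x \<otimes> \<guillemotleft>e j * c j x\<guillemotright>)" .
  qed (use F in \<open>auto intro!: finsum_closed\<close>)
  also have "\<dots> = (\<Oplus>x\<in>D. \<Oplus>j\<in>J. F x \<otimes> \<guillemotleft>e j * c j x\<guillemotright>)"
    using F assms(1,2) by (intro finsum_swap) auto
  also have "\<dots> = (\<Oplus>x\<in>D. if x = d then F x \<otimes> \<guillemotleft>N\<guillemotright> else \<zero>)"
  proof (intro finsum_cong'[OF refl])
    fix x assume x: "x \<in> D"
    have "(\<Oplus>j\<in>J. F x \<otimes> \<guillemotleft>e j * c j x\<guillemotright>) = F x \<otimes> \<guillemotleft>\<Sum>j\<in>J. e j * c j x\<guillemotright>"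
      unfolding of_int_sum using F[OF x] assms(2) by (intro finsum_rdistr[symmetric]) auto
    then show "(\<Oplus>j\<in>J. F x \<otimes> \<guillemotleft>e j * c j x\<guillemotright>) = (if x = d then F x \<otimes> \<guillemotleft>N\<guillemotright> else \<zero>)"
      using F[OF x] by (simp add: orth[OF x])
  qed (use F in auto)
  also have "\<dots> = F d \<otimes> \<guillemotleft>N\<guillemotright>"
    using F assms by (intro add.finprod_singleton_swap) auto
  finally show ?thesis .
qed

lemma (in domain) d8_transform_inj:
  assumes "F \<in> carrier D8 \<rightarrow> carrier R" "F' \<in> carrier D8 \<rightarrow> carrier R" "\<guillemotleft>2\<guillemotright> \<noteq> \<zero>"
    and char: "\<And>n. n < 4 \<Longrightarrow> (\<Oplus>x\<in>carrier D8. F x \<otimes> \<guillemotleft>d8_char n x\<guillemotright>) =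
      (\<Oplus>x\<in>carrier D8. F' x \<otimes> \<guillemotleft>d8_char n x\<guillemotright>)"
    and rep: "\<And>a b. a < 2 \<Longrightarrow> b < 2 \<Longrightarrow> (\<Oplus>x\<in>carrier D8. F x \<otimes> \<guillemotleft>d8_rep a b x\<guillemotright>) =
      (\<Oplus>x\<in>carrier D8. F' x \<otimes> \<guillemotleft>d8_rep a b x\<guillemotright>)"
    and d: "d \<in> carrier D8"
  shows "F d = F' d"
proof -
  \<comment> \<open>The left summand indexes the four linear characters, the right one the four
    matrix entries: eight functions on eight group elements. The 2 in \<open>e\<close> is the degree
    of the matrix representation.\<close>
  define c where "c j = (case j of Inl n \<Rightarrow> d8_char n | Inr (a, b) \<Rightarrow> d8_rep a b)"
    for j :: "nat + nat \<times> nat"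
  define e where "e j = (case j of Inl n \<Rightarrow> d8_char n d | Inr (a, b) \<Rightarrow> 2 * d8_rep a b d)"
    for j :: "nat + nat \<times> nat"
  define J :: "(nat + nat \<times> nat) set" where "J = {..<4} <+> ({..<2} \<times> {..<2})"
  have orth: "(\<Sum>j\<in>J. e j * c j x) = (if x = d then 8 else 0)" if "x \<in> carrier D8" for x
    using d8_column_orthogonality[OF d that]
    by (simp add: J_def c_def e_def sum.Plus sum.cartesian_product sum_distrib_left mult.assoc
        case_prod_unfold)
  have fin: "finite J" "finite (carrier D8)" by (simp_all add: J_def carrier_D8)
  have "(\<Oplus>x\<in>carrier D8. F x \<otimes> \<guillemotleft>c j x\<guillemotright>) = (\<Oplus>x\<in>carrier D8. F' x \<otimes> \<guillemotleft>c j x\<guillemotright>)" if "j \<in> J" for j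
    using that char rep by (auto simp: J_def c_def)
  then have "(\<Oplus>j\<in>J. \<guillemotleft>e j\<guillemotright> \<otimes> (\<Oplus>x\<in>carrier D8. F x \<otimes> \<guillemotleft>c j x\<guillemotright>)) =
      (\<Oplus>j\<in>J. \<guillemotleft>e j\<guillemotright> \<otimes> (\<Oplus>x\<in>carrier D8. F' x \<otimes> \<guillemotleft>c j x\<guillemotright>))"
    using assms(2) by (intro finsum_cong'[OF refl]) (auto simp: Pi_def intro!: finsum_closed m_closed)
  then have "F d \<otimes> \<guillemotleft>8\<guillemotright> = F' d \<otimes> \<guillemotleft>8\<guillemotright>"
    using finsum_column_orthogonality[OF fin(2,1) _ d orth] assms(1,2) by simp
  \<comment> \<open>The constant 8 is the order of D8; being a power of 2, it is nonzero in a domain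
    where 2 is.\<close>
  moreover have "\<guillemotleft>8\<guillemotright> = \<guillemotleft>2\<guillemotright> \<otimes> \<guillemotleft>2\<guillemotright> \<otimes> \<guillemotleft>2\<guillemotright>" by (simp flip: of_int_mult)
  then have "\<guillemotleft>8\<guillemotright> \<noteq> \<zero>"
    using assms(3) by (simp add: integral_iff)
  moreover have "F d \<in> carrier R" "F' d \<in> carrier R" using assms(1,2) d by auto
  ultimately show ?thesis by (simp add: m_rcancel)
qed

section \<open>Inversion over the cyclic factor\<close>

text \<open>Adding the three values leaves 3 x0, because 1 + w + w^2 = 0 cancels the rest. The other
  coefficients come from the same formula after a cyclic rotation.\<close>

lemma (in domain) cube_root_transform_inj:
  assumes w: "w \<in> carrier R" "v \<in> carrier R" "w \<otimes> w = v" "v \<otimes> w = \<one>" "\<one> \<oplus> w \<oplus> v = \<zero>"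
    and three: "\<guillemotleft>3\<guillemotright> \<noteq> \<zero>"
    and x: "x0 \<in> carrier R" "x1 \<in> carrier R" "x2 \<in> carrier R"
    and y: "y0 \<in> carrier R" "y1 \<in> carrier R" "y2 \<in> carrier R"
    and eq: "x0 \<oplus> x1 \<oplus> x2 = y0 \<oplus> y1 \<oplus> y2"
      "x0 \<oplus> x1 \<otimes> w \<oplus> x2 \<otimes> v = y0 \<oplus> y1 \<otimes> w \<oplus> y2 \<otimes> v"
      "x0 \<oplus> x1 \<otimes> v \<oplus> x2 \<otimes> w = y0 \<oplus> y1 \<otimes> v \<oplus> y2 \<otimes> w"
  shows "x0 = y0 \<and> x1 = y1 \<and> x2 = y2"
proof -
  have vv: "v \<otimes> v = w" using w by (metis m_assoc m_comm r_one)
  have three': "\<guillemotleft>3\<guillemotright> = \<one> \<oplus> \<one> \<oplus> \<one>"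
    using of_int_add[of 2 1] by (simp add: of_int_2)
  have first: "(a0 \<oplus> a1 \<oplus> a2) \<oplus> (a0 \<oplus> a1 \<otimes> w \<oplus> a2 \<otimes> v) \<oplus> (a0 \<oplus> a1 \<otimes> v \<oplus> a2 \<otimes> w) = \<guillemotleft>3\<guillemotright> \<otimes> a0"
    if "a0 \<in> carrier R" "a1 \<in> carrier R" "a2 \<in> carrier R" for a0 a1 a2
  proof -
    have "(a0 \<oplus> a1 \<oplus> a2) \<oplus> (a0 \<oplus> a1 \<otimes> w \<oplus> a2 \<otimes> v) \<oplus> (a0 \<oplus> a1 \<otimes> v \<oplus> a2 \<otimes> w) =
        (\<one> \<oplus> \<one> \<oplus> \<one>) \<otimes> a0 \<oplus> (a1 \<oplus> a2) \<otimes> (\<one> \<oplus> w \<oplus> v)"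
      using that w(1,2) by algebra
    then show ?thesis using that by (simp add: w(5) three')
  qed
  \<comment> \<open>Since \<open>v\<close> and \<open>w\<close> are mutually inverse, these
    multiplications rotate the coefficients, turning the equations for (x0, x1, x2) into those for
    (x1, x2, x0).\<close>
  have shift: "v \<otimes> (a0 \<oplus> a1 \<otimes> w \<oplus> a2 \<otimes> v) = a1 \<oplus> a2 \<otimes> w \<oplus> a0 \<otimes> v"
    "w \<otimes> (a0 \<oplus> a1 \<otimes> v \<oplus> a2 \<otimes> w) = a1 \<oplus> a2 \<otimes> v \<oplus> a0 \<otimes> w"
    if "a0 \<in> carrier R" "a1 \<in> carrier R" "a2 \<in> carrier R" for a0 a1 a2
  proof -
    have "v \<otimes> (a0 \<oplus> a1 \<otimes> w \<oplus> a2 \<otimes> v) = a1 \<otimes> (v \<otimes> w) \<oplus> a2 \<otimes> (v \<otimes> v) \<oplus> a0 \<otimes> v"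
      using that w(1,2) by algebra
    then show "v \<otimes> (a0 \<oplus> a1 \<otimes> w \<oplus> a2 \<otimes> v) = a1 \<oplus> a2 \<otimes> w \<oplus> a0 \<otimes> v"
      using that by (simp add: vv w(4))
    have "w \<otimes> (a0 \<oplus> a1 \<otimes> v \<oplus> a2 \<otimes> w) = a1 \<otimes> (v \<otimes> w) \<oplus> a2 \<otimes> (w \<otimes> w) \<oplus> a0 \<otimes> w"
      using that w(1,2) by algebra
    then show "w \<otimes> (a0 \<oplus> a1 \<otimes> v \<oplus> a2 \<otimes> w) = a1 \<oplus> a2 \<otimes> v \<oplus> a0 \<otimes> w"
      using that by (simp add: w(3,4))
  qed
  have cancel: "a = b" if "\<guillemotleft>3\<guillemotright> \<otimes> a = \<guillemotleft>3\<guillemotright> \<otimes> b" "a \<in> carrier R" "b \<in> carrier R" for a b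
    using that three by (simp add: m_lcancel)
  have rotate: "a1 \<oplus> a2 \<oplus> a0 = a0 \<oplus> a1 \<oplus> a2"
    if "a0 \<in> carrier R" "a1 \<in> carrier R" "a2 \<in> carrier R" for a0 a1 a2
    using that by (simp add: a_ac)
  have eq': "x1 \<oplus> x2 \<oplus> x0 = y1 \<oplus> y2 \<oplus> y0"
      "x1 \<oplus> x2 \<otimes> w \<oplus> x0 \<otimes> v = y1 \<oplus> y2 \<otimes> w \<oplus> y0 \<otimes> v"
      "x1 \<oplus> x2 \<otimes> v \<oplus> x0 \<otimes> w = y1 \<oplus> y2 \<otimes> v \<oplus> y0 \<otimes> w"
    using eq rotate[OF x] rotate[OF y] shift[OF x] shift[OF y] by metis+
  have eq'': "x2 \<oplus> x0 \<oplus> x1 = y2 \<oplus> y0 \<oplus> y1"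
      "x2 \<oplus> x0 \<otimes> w \<oplus> x1 \<otimes> v = y2 \<oplus> y0 \<otimes> w \<oplus> y1 \<otimes> v"
      "x2 \<oplus> x0 \<otimes> v \<oplus> x1 \<otimes> w = y2 \<oplus> y0 \<otimes> v \<oplus> y1 \<otimes> w"
    using eq' rotate[OF x(2,3,1)] rotate[OF y(2,3,1)] shift[OF x(2,3,1)] shift[OF y(2,3,1)] by metis+
  have "\<guillemotleft>3\<guillemotright> \<otimes> x0 = \<guillemotleft>3\<guillemotright> \<otimes> y0"
    unfolding first[OF x, symmetric] first[OF y, symmetric] eq ..
  moreover have "\<guillemotleft>3\<guillemotright> \<otimes> x1 = \<guillemotleft>3\<guillemotright> \<otimes> y1"
    unfolding first[OF x(2,3,1), symmetric] first[OF y(2,3,1), symmetric] eq' ..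
  moreover have "\<guillemotleft>3\<guillemotright> \<otimes> x2 = \<guillemotleft>3\<guillemotright> \<otimes> y2"
    unfolding first[OF x(3,1,2), symmetric] first[OF y(3,1,2), symmetric] eq'' ..
  ultimately show ?thesis using cancel x y by blast
qed

lemma (in domain) cube_root_of_unity:
  assumes "w \<in> carrier R" "w \<noteq> \<one>" "w [^] (3::nat) = \<one>"
  shows "w \<otimes> w \<otimes> w = \<one>" and "\<one> \<oplus> w \<oplus> w \<otimes> w = \<zero>"
proof -
  show cube: "w \<otimes> w \<otimes> w = \<one>" using assms by (simp add: numeral_3_eq_3)
  have "(w \<ominus> \<one>) \<otimes> (\<one> \<oplus> w \<oplus> w \<otimes> w) = w \<otimes> w \<otimes> w \<ominus> \<one>"
    using assms(1) by algebra
  then have "(w \<ominus> \<one>) \<otimes> (\<one> \<oplus> w \<oplus> w \<otimes> w) = \<zero>" using cube by simp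
  then show "\<one> \<oplus> w \<oplus> w \<otimes> w = \<zero>" using assms(1,2) by (simp add: integral_iff)
qed

lemma field_hom_inj:
  assumes "field R" "field K" "h \<in> Ring.ring_hom R K"
  shows "inj_on h (carrier R)"
proof -
  interpret R: field R by fact
  interpret K: field K by fact
  have hom: "ring_hom_ring R K h"
    using R.ring_axioms K.ring_axioms assms(3) by (rule ring_hom_ringI2)
  have "h \<one>\<^bsub>R\<^esub> \<noteq> \<zero>\<^bsub>K\<^esub>"
    using ring_hom_one[OF assms(3)] by simp
  then have "h ` carrier R \<noteq> {\<zero>\<^bsub>K\<^esub>}" by blast
  then show ?thesis
    using ring_hom_ring.non_trivial_field_hom_imp_inj[OF hom R.field_axioms] by blast
qed

text \<open>With w^2 = -1 - w the second equation becomes a linear relation between 1 and w over the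
  image of R. As w lies outside that image, both coefficients vanish, so the three differences xi -
  yi agree; the first equation then makes three times their common value zero.\<close>

lemma quadratic_transform_inj:
  assumes R: "field R" and K: "field K" and h: "h \<in> Ring.ring_hom R K"
    and three: "\<guillemotleft>3\<guillemotright>\<^bsub>R\<^esub> \<noteq> \<zero>\<^bsub>R\<^esub>"
    and w: "w \<in> carrier K" "w \<notin> h ` carrier R" "\<one>\<^bsub>K\<^esub> \<oplus>\<^bsub>K\<^esub> w \<oplus>\<^bsub>K\<^esub> w \<otimes>\<^bsub>K\<^esub> w = \<zero>\<^bsub>K\<^esub>"
    and x: "x0 \<in> carrier R" "x1 \<in> carrier R" "x2 \<in> carrier R"
    and y: "y0 \<in> carrier R" "y1 \<in> carrier R" "y2 \<in> carrier R"
    and eq: "x0 \<oplus>\<^bsub>R\<^esub> x1 \<oplus>\<^bsub>R\<^esub> x2 = y0 \<oplus>\<^bsub>R\<^esub> y1 \<oplus>\<^bsub>R\<^esub> y2"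
      "h x0 \<oplus>\<^bsub>K\<^esub> h x1 \<otimes>\<^bsub>K\<^esub> w \<oplus>\<^bsub>K\<^esub> h x2 \<otimes>\<^bsub>K\<^esub> (w \<otimes>\<^bsub>K\<^esub> w) =
       h y0 \<oplus>\<^bsub>K\<^esub> h y1 \<otimes>\<^bsub>K\<^esub> w \<oplus>\<^bsub>K\<^esub> h y2 \<otimes>\<^bsub>K\<^esub> (w \<otimes>\<^bsub>K\<^esub> w)"
  shows "x0 = y0 \<and> x1 = y1 \<and> x2 = y2"
proof -
  interpret R: field R by fact
  interpret K: field K by fact
  interpret ring_hom_cring R K h
    by unfold_locales (rule h)
  define d where "d x y = x \<ominus>\<^bsub>R\<^esub> y" for x y
  have d: "d x y \<in> carrier R" "h (d x y) = h x \<ominus>\<^bsub>K\<^esub> h y"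
    if "x \<in> carrier R" "y \<in> carrier R" for x y
    using that by (simp_all add: d_def a_minus_def)
  \<comment> \<open>The coefficients of 1 and w in the difference of the two sides of
    \<open>eq(2)\<close> once w^2 is eliminated.\<close>
  let ?a = "d (d x0 y0) (d x2 y2)" and ?b = "d (d x1 y1) (d x2 y2)"
  have hx: "h x0 \<in> carrier K" "h x1 \<in> carrier K" "h x2 \<in> carrier K"
    and hy: "h y0 \<in> carrier K" "h y1 \<in> carrier K" "h y2 \<in> carrier K"
    using x y by auto
  \<comment> \<open>The last subtracted term is a multiple of 1 + w + w^2 = 0; it is what removes
    w^2.\<close>
  have "h ?a \<oplus>\<^bsub>K\<^esub> h ?b \<otimes>\<^bsub>K\<^esub> w =
    (h x0 \<oplus>\<^bsub>K\<^esub> h x1 \<otimes>\<^bsub>K\<^esub> w \<oplus>\<^bsub>K\<^esub> h x2 \<otimes>\<^bsub>K\<^esub> (w \<otimes>\<^bsub>K\<^esub> w)) \<ominus>\<^bsub>K\<^esub>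
    (h y0 \<oplus>\<^bsub>K\<^esub> h y1 \<otimes>\<^bsub>K\<^esub> w \<oplus>\<^bsub>K\<^esub> h y2 \<otimes>\<^bsub>K\<^esub> (w \<otimes>\<^bsub>K\<^esub> w)) \<ominus>\<^bsub>K\<^esub>
    (h x2 \<ominus>\<^bsub>K\<^esub> h y2) \<otimes>\<^bsub>K\<^esub> (\<one>\<^bsub>K\<^esub> \<oplus>\<^bsub>K\<^esub> w \<oplus>\<^bsub>K\<^esub> w \<otimes>\<^bsub>K\<^esub> w)"
    using x y hx hy w(1) by (simp only: d) algebra
  then have lin: "h ?a \<oplus>\<^bsub>K\<^esub> h ?b \<otimes>\<^bsub>K\<^esub> w = \<zero>\<^bsub>K\<^esub>"
    using hx hy w(1) unfolding eq(2) w(3) by (simp add: K.r_neg a_minus_def)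
  have b0: "?b = \<zero>\<^bsub>R\<^esub>"
  proof (rule ccontr)
    assume b: "?b \<noteq> \<zero>\<^bsub>R\<^esub>"
    let ?i = "inv\<^bsub>R\<^esub> ?b"
    have i: "?i \<in> carrier R" "?b \<otimes>\<^bsub>R\<^esub> ?i = \<one>\<^bsub>R\<^esub>"
      using b x y d by (auto simp: R.field_Units intro!: R.Units_inv_closed R.Units_r_inv)
    have hb: "h ?b \<otimes>\<^bsub>K\<^esub> h ?i = \<one>\<^bsub>K\<^esub>"
      using i x y d(1) by (simp flip: hom_mult)
    have c: "h ?a \<in> carrier K" "h ?b \<in> carrier K" "h ?i \<in> carrier K"
      using x y d(1) i by auto
    \<comment> \<open>With b invertible, the linear relation would give w = -a/b, an element of the
      image of R.\<close>
    have "w = (h ?b \<otimes>\<^bsub>K\<^esub> h ?i) \<otimes>\<^bsub>K\<^esub> w" using w(1) by (simp add: hb)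
    also have "\<dots> = (h ?a \<oplus>\<^bsub>K\<^esub> h ?b \<otimes>\<^bsub>K\<^esub> w) \<otimes>\<^bsub>K\<^esub> h ?i \<ominus>\<^bsub>K\<^esub> h ?a \<otimes>\<^bsub>K\<^esub> h ?i"
      using c w(1) by algebra
    also have "\<dots> = h (\<ominus>\<^bsub>R\<^esub> (?a \<otimes>\<^bsub>R\<^esub> ?i))"
      using c x y d(1) i unfolding lin by (simp add: a_minus_def)
    finally have "w = h (\<ominus>\<^bsub>R\<^esub> (?a \<otimes>\<^bsub>R\<^esub> ?i))" .
    moreover have "\<ominus>\<^bsub>R\<^esub> (?a \<otimes>\<^bsub>R\<^esub> ?i) \<in> carrier R" using x y d(1) i by simp
    ultimately show False using w(2) by blast
  qed
  have a0: "?a = \<zero>\<^bsub>R\<^esub>"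
  proof -
    have "h ?a = h \<zero>\<^bsub>R\<^esub>" using lin b0 x y d(1) w(1) by simp
    moreover have "inj_on h (carrier R)"
      using R K h by (rule field_hom_inj)
    moreover have "?a \<in> carrier R" using x y d(1) by simp
    ultimately show ?thesis using R.zero_closed by (simp only: inj_on_eq_iff)
  qed
  \<comment> \<open>Vanishing of \<open>?a\<close> and \<open>?b\<close> says that all three
    differences equal this one.\<close>
  let ?t = "d x2 y2"
  have e: "d x0 y0 = ?t" "d x1 y1 = ?t"
    using a0 b0 x y d(1) by (simp_all add: d_def)
  have "d x0 y0 \<oplus>\<^bsub>R\<^esub> d x1 y1 \<oplus>\<^bsub>R\<^esub> d x2 y2 =
      (x0 \<oplus>\<^bsub>R\<^esub> x1 \<oplus>\<^bsub>R\<^esub> x2) \<ominus>\<^bsub>R\<^esub> (y0 \<oplus>\<^bsub>R\<^esub> y1 \<oplus>\<^bsub>R\<^esub> y2)"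
    using x y unfolding d_def by algebra
  also have "\<dots> = \<zero>\<^bsub>R\<^esub>" using x y unfolding eq(1) by (simp add: R.r_neg a_minus_def)
  finally have "?t \<oplus>\<^bsub>R\<^esub> ?t \<oplus>\<^bsub>R\<^esub> ?t = \<zero>\<^bsub>R\<^esub>" unfolding e .
  moreover have "\<guillemotleft>3\<guillemotright>\<^bsub>R\<^esub> = \<one>\<^bsub>R\<^esub> \<oplus>\<^bsub>R\<^esub> \<one>\<^bsub>R\<^esub> \<oplus>\<^bsub>R\<^esub> \<one>\<^bsub>R\<^esub>"
    using R.of_int_add[of 2 1] by (simp add: R.of_int_2)
  ultimately have "\<guillemotleft>3\<guillemotright>\<^bsub>R\<^esub> \<otimes>\<^bsub>R\<^esub> ?t = \<zero>\<^bsub>R\<^esub>"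
    using x y d(1) by (simp add: R.l_distr)
  then have "?t = \<zero>\<^bsub>R\<^esub>" using three x y d(1) by (simp add: R.integral_iff)
  then have "d x0 y0 = \<zero>\<^bsub>R\<^esub>" "d x1 y1 = \<zero>\<^bsub>R\<^esub>" "d x2 y2 = \<zero>\<^bsub>R\<^esub>"
    using e by simp_all
  then show ?thesis using x y by (simp add: d_def)
qed

section \<open>The transforms on the group algebra of the product\<close>

text \<open>This rule would turn natural exponents into integer ones, whose laws need a group and not
  just the multiplicative monoid of a ring.\<close>

declare pow_nat [simp del]

abbreviation "C3D8 \<equiv> integer_mod_group 3 \<times>\<times> D8"

lemma carrier_C3: "carrier (integer_mod_group 3) = {0, 1, 2}"
  by (auto simp: carrier_integer_mod_group)

lemma group_C3D8: "group C3D8"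
  by (intro DirProd_group group_integer_mod_group group_dihedral_group) simp

lemma finite_C3D8: "finite (carrier C3D8)" and card_C3D8: "card (carrier C3D8) = 24"
  by (simp_all add: carrier_C3 carrier_D8 card_cartesian_product)

definition twist :: "('a, 'm) ring_scheme \<Rightarrow> 'a \<Rightarrow> (int \<times> bool \<Rightarrow> int) \<Rightarrow> int \<times> int \<times> bool \<Rightarrow> 'a" where
  "twist K w c = (\<lambda>(i, d). w [^]\<^bsub>K\<^esub> nat i \<otimes>\<^bsub>K\<^esub> \<guillemotleft>c d\<guillemotright>\<^bsub>K\<^esub>)"

definition char_transform ::
    "('b, 'n) ring_scheme \<Rightarrow> ('a \<Rightarrow> 'b) \<Rightarrow> 'b \<Rightarrow> nat \<Rightarrow> (int \<times> int \<times> bool \<Rightarrow> 'a) \<Rightarrow> 'b" where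
  "char_transform K h w n = weighted_sum K h C3D8 (twist K w (d8_char n))"

definition rep_transform ::
    "('b, 'n) ring_scheme \<Rightarrow> ('a \<Rightarrow> 'b) \<Rightarrow> 'b \<Rightarrow> (int \<times> int \<times> bool \<Rightarrow> 'a) \<Rightarrow> 'b mat" where
  "rep_transform K h w = (\<lambda>f. mat 2 2 (\<lambda>(a, b). weighted_sum K h C3D8 (twist K w (d8_rep a b)) f))"

text \<open>The root need not be primitive: w = 1 belongs to the trivial character of C3 and
  supplies the factors over the ground field in the quadratic case.\<close>

locale cube_root_twist = coefficient_change R K h C3D8
  for R (structure) and K (structure) and h +
  fixes w
  assumes w_closed [simp]: "w \<in> carrier K" and w_cubed: "w [^]\<^bsub>K\<^esub> (3::nat) = \<one>\<^bsub>K\<^esub>"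
begin

lemma pow_mod_3: "w [^]\<^bsub>K\<^esub> (n mod 3) = w [^]\<^bsub>K\<^esub> (n :: nat)"
  by (metis w_closed w_cubed mod_mult_div_eq S.nat_pow_mult S.nat_pow_pow S.nat_pow_one
      S.nat_pow_closed S.r_one)

lemma twist_closed: "twist K w c \<in> carrier C3D8 \<rightarrow> carrier K"
  by (auto simp: twist_def)

lemma pow_mult_C3:
  assumes "i \<in> carrier (integer_mod_group 3)" "j \<in> carrier (integer_mod_group 3)"
  shows "w [^]\<^bsub>K\<^esub> nat ((i + j) mod 3) = w [^]\<^bsub>K\<^esub> nat i \<otimes>\<^bsub>K\<^esub> w [^]\<^bsub>K\<^esub> nat j"
proof -
  have "0 \<le> i" "0 \<le> j" using assms by (auto simp: carrier_C3)
  then have "nat ((i + j) mod 3) = (nat i + nat j) mod 3"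
    by (simp add: nat_mod_distrib nat_add_distrib)
  then show ?thesis by (simp only: pow_mod_3) (simp add: S.nat_pow_mult)
qed

lemma twist_mult_twist:
  assumes "(i, d) \<in> carrier C3D8" "(j, e) \<in> carrier C3D8"
  shows "twist K w c (i, d) \<otimes>\<^bsub>K\<^esub> twist K w c' (j, e) =
    w [^]\<^bsub>K\<^esub> nat ((i + j) mod 3) \<otimes>\<^bsub>K\<^esub> \<guillemotleft>c d * c' e\<guillemotright>\<^bsub>K\<^esub>"
  using assms by (simp add: twist_def pow_mult_C3 S.m_ac)

lemma twist_char_hom: "twist K w (d8_char n) \<in> hom C3D8 K"
proof (rule homI)
  fix x y assume x: "x \<in> carrier C3D8" and y: "y \<in> carrier C3D8"
  obtain i d j e where [simp]: "x = (i, d)" "y = (j, e)" by (cases x; cases y)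
  have "twist K w (d8_char n) (x \<otimes>\<^bsub>C3D8\<^esub> y) =
    w [^]\<^bsub>K\<^esub> nat ((i + j) mod 3) \<otimes>\<^bsub>K\<^esub> \<guillemotleft>d8_char n d * d8_char n e\<guillemotright>\<^bsub>K\<^esub>"
    using x y by (simp add: twist_def d8_char_mult)
  then show "twist K w (d8_char n) (x \<otimes>\<^bsub>C3D8\<^esub> y) =
      twist K w (d8_char n) x \<otimes>\<^bsub>K\<^esub> twist K w (d8_char n) y"
    using twist_mult_twist x y by simp
qed (use twist_closed in auto)

lemma twist_rep_hom:
  "(\<lambda>x. mat 2 2 (\<lambda>(a, b). twist K w (d8_rep a b) x)) \<in> hom C3D8 (matrix_ring 2 K)"
proof (rule homI)
  fix x assume "x \<in> carrier C3D8"
  then show "mat 2 2 (\<lambda>(a, b). twist K w (d8_rep a b) x) \<in> carrier (matrix_ring 2 K)"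
    using twist_closed by (auto simp: matrix_ring_def Pi_def dest!: elements_matD)
next
  fix x y assume x: "x \<in> carrier C3D8" and y: "y \<in> carrier C3D8"
  obtain i d j e where xy: "x = (i, d)" "y = (j, e)" by (cases x; cases y)
  have "twist K w (d8_rep a b) (x \<otimes>\<^bsub>C3D8\<^esub> y) =
    (\<Oplus>\<^bsub>K\<^esub>k\<in>{..<2}. twist K w (d8_rep a k) x \<otimes>\<^bsub>K\<^esub> twist K w (d8_rep k b) y)"
    if "a < 2" "b < 2" for a b
  proof -
    have "twist K w (d8_rep a b) (x \<otimes>\<^bsub>C3D8\<^esub> y) =
      w [^]\<^bsub>K\<^esub> nat ((i + j) mod 3) \<otimes>\<^bsub>K\<^esub> (\<Oplus>\<^bsub>K\<^esub>k\<in>{..<2}. \<guillemotleft>d8_rep a k d * d8_rep k b e\<guillemotright>\<^bsub>K\<^esub>)"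
      using x y that unfolding xy by (simp add: twist_def d8_rep_mult S.of_int_sum del: S.of_int_mult)
    also have "\<dots> = (\<Oplus>\<^bsub>K\<^esub>k\<in>{..<2}.
        w [^]\<^bsub>K\<^esub> nat ((i + j) mod 3) \<otimes>\<^bsub>K\<^esub> \<guillemotleft>d8_rep a k d * d8_rep k b e\<guillemotright>\<^bsub>K\<^esub>)"
      by (intro S.finsum_rdistr) auto
    also have "\<dots> = (\<Oplus>\<^bsub>K\<^esub>k\<in>{..<2}. twist K w (d8_rep a k) x \<otimes>\<^bsub>K\<^esub> twist K w (d8_rep k b) y)"
      using x y twist_closed unfolding xy
      by (intro S.finsum_cong'[OF refl]) (simp_all add: twist_mult_twist Pi_def del: S.of_int_mult)
    finally show ?thesis .
  qed
  moreover have "twist K w c x \<in> carrier K" "twist K w c y \<in> carrier K" for c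
    using twist_closed x y by auto
  ultimately show "mat 2 2 (\<lambda>(a, b). twist K w (d8_rep a b) (x \<otimes>\<^bsub>C3D8\<^esub> y)) =
      mat 2 2 (\<lambda>(a, b). twist K w (d8_rep a b) x) \<otimes>\<^bsub>matrix_ring 2 K\<^esub>
      mat 2 2 (\<lambda>(a, b). twist K w (d8_rep a b) y)"
    by (intro eq_matI) (auto simp: matrix_ring_def intro!: S.finsum_cong')
qed

lemma twist_one: "twist K w c \<one>\<^bsub>C3D8\<^esub> = \<guillemotleft>c \<one>\<^bsub>D8\<^esub>\<guillemotright>\<^bsub>K\<^esub>"
  by (simp add: twist_def)

lemma char_transform_hom: "char_transform K h w n \<in> hom (group_algebra R C3D8) K"
  unfolding char_transform_def by (rule weighted_sum_hom[OF twist_char_hom])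

lemma char_transform_one: "char_transform K h w n \<one>\<^bsub>group_algebra R C3D8\<^esub> = \<one>\<^bsub>K\<^esub>"
  unfolding char_transform_def weighted_sum_one[OF twist_closed] twist_one by simp

lemma rep_transform_hom: "rep_transform K h w \<in> hom (group_algebra R C3D8) (matrix_ring 2 K)"
proof -
  \<comment> \<open>The entrywise weights are recast as entries of one matrix-valued map, the form
    required by \<open>weighted_sum_matrix_hom\<close>.\<close>
  have "rep_transform K h w = (\<lambda>f. mat 2 2 (\<lambda>ij. weighted_sum K h C3D8
      (\<lambda>x. mat 2 2 (\<lambda>(a, b). twist K w (d8_rep a b) x) $$ ij) f))"
    unfolding rep_transform_def by (intro ext eq_matI) simp_all
  then show ?thesis using weighted_sum_matrix_hom[OF twist_rep_hom] by simp
qed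

lemma rep_transform_one:
  "rep_transform K h w \<one>\<^bsub>group_algebra R C3D8\<^esub> = \<one>\<^bsub>matrix_ring 2 K\<^esub>"
  unfolding rep_transform_def weighted_sum_one[OF twist_closed] twist_one
  by (intro eq_matI) (auto simp: matrix_ring_def d8_rep_one)

text \<open>With FG read as (F C3) D8, this is the coefficient of \<open>d\<close> evaluated under
  the map from F C3 to K that sends the generator of C3 to \<open>w\<close>.\<close>

definition slice :: "(int \<times> int \<times> bool \<Rightarrow> 'a) \<Rightarrow> int \<times> bool \<Rightarrow> 'c" where
  "slice f d = h (f (0, d)) \<oplus>\<^bsub>K\<^esub> h (f (1, d)) \<otimes>\<^bsub>K\<^esub> w \<oplus>\<^bsub>K\<^esub> h (f (2, d)) \<otimes>\<^bsub>K\<^esub> (w \<otimes>\<^bsub>K\<^esub> w)"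

lemma slice_closed:
  "f \<in> carrier C3D8 \<rightarrow> carrier R \<Longrightarrow> slice f \<in> carrier D8 \<rightarrow> carrier K"
  by (auto simp: slice_def carrier_C3 Pi_def)

text \<open>Separates the two factors: every transform for the root \<open>w\<close> is a D8
  transform of the same function \<open>slice f\<close>, whichever \<open>c\<close> is used.\<close>

lemma weighted_sum_twist:
  assumes "f \<in> carrier C3D8 \<rightarrow> carrier R"
  shows "weighted_sum K h C3D8 (twist K w c) f = (\<Oplus>\<^bsub>K\<^esub>d\<in>carrier D8. slice f d \<otimes>\<^bsub>K\<^esub> \<guillemotleft>c d\<guillemotright>\<^bsub>K\<^esub>)"
proof -
  have f: "h (f (i, d)) \<in> carrier K" if "i \<in> {0, 1, 2}" "d \<in> carrier D8" for i d
    using assms that by (auto simp: carrier_C3)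
  have fin: "finite (carrier D8)" by (simp add: carrier_D8)
  have "weighted_sum K h C3D8 (twist K w c) f =
    (\<Oplus>\<^bsub>K\<^esub>i\<in>{0, 1, 2}. \<Oplus>\<^bsub>K\<^esub>d\<in>carrier D8. h (f (i, d)) \<otimes>\<^bsub>K\<^esub> twist K w c (i, d))"
    unfolding weighted_sum_def carrier_DirProd carrier_C3 using f fin
    by (intro S.finsum_cartesian_product) (auto simp: twist_def)
  also have "\<dots> = (\<Oplus>\<^bsub>K\<^esub>d\<in>carrier D8. \<Oplus>\<^bsub>K\<^esub>i\<in>{0, 1, 2}. h (f (i, d)) \<otimes>\<^bsub>K\<^esub> twist K w c (i, d))"
    using f fin by (intro S.finsum_swap) (auto simp: twist_def)
  also have "\<dots> = (\<Oplus>\<^bsub>K\<^esub>d\<in>carrier D8. slice f d \<otimes>\<^bsub>K\<^esub> \<guillemotleft>c d\<guillemotright>\<^bsub>K\<^esub>)"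
  proof (intro S.finsum_cong'[OF refl])
    fix d assume d: "d \<in> carrier D8"
    have e: "twist K w c (0, d) = \<guillemotleft>c d\<guillemotright>\<^bsub>K\<^esub>" "twist K w c (1, d) = w \<otimes>\<^bsub>K\<^esub> \<guillemotleft>c d\<guillemotright>\<^bsub>K\<^esub>"
      "twist K w c (2, d) = w \<otimes>\<^bsub>K\<^esub> w \<otimes>\<^bsub>K\<^esub> \<guillemotleft>c d\<guillemotright>\<^bsub>K\<^esub>"
      by (simp_all add: twist_def numeral_2_eq_2)
    have fd: "h (f (0, d)) \<in> carrier K" "h (f (1, d)) \<in> carrier K" "h (f (2, d)) \<in> carrier K"
      using f d by auto
    have "(\<Oplus>\<^bsub>K\<^esub>i\<in>{0, 1, 2}. h (f (i, d)) \<otimes>\<^bsub>K\<^esub> twist K w c (i, d)) =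
      h (f (0, d)) \<otimes>\<^bsub>K\<^esub> \<guillemotleft>c d\<guillemotright>\<^bsub>K\<^esub> \<oplus>\<^bsub>K\<^esub> (h (f (1, d)) \<otimes>\<^bsub>K\<^esub> (w \<otimes>\<^bsub>K\<^esub> \<guillemotleft>c d\<guillemotright>\<^bsub>K\<^esub>) \<oplus>\<^bsub>K\<^esub>
        h (f (2, d)) \<otimes>\<^bsub>K\<^esub> (w \<otimes>\<^bsub>K\<^esub> w \<otimes>\<^bsub>K\<^esub> \<guillemotleft>c d\<guillemotright>\<^bsub>K\<^esub>))"
      using fd by (simp add: e)
    also have "\<dots> = slice f d \<otimes>\<^bsub>K\<^esub> \<guillemotleft>c d\<guillemotright>\<^bsub>K\<^esub>"
      using fd unfolding slice_def by (simp add: S.l_distr S.m_assoc S.a_assoc)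
    finally show "(\<Oplus>\<^bsub>K\<^esub>i\<in>{0, 1, 2}. h (f (i, d)) \<otimes>\<^bsub>K\<^esub> twist K w c (i, d)) =
      slice f d \<otimes>\<^bsub>K\<^esub> \<guillemotleft>c d\<guillemotright>\<^bsub>K\<^esub>" .
  qed (use slice_closed[OF assms] in auto)
  finally show ?thesis .
qed

text \<open>The D8 stage of the inversion, for one fixed root. The coefficients themselves are
  recovered only by comparing slices for several roots.\<close>

lemma slice_eqI:
  assumes "domain K" "\<guillemotleft>2\<guillemotright>\<^bsub>K\<^esub> \<noteq> \<zero>\<^bsub>K\<^esub>"
    and f: "f \<in> carrier (group_algebra R C3D8)" and g: "g \<in> carrier (group_algebra R C3D8)"
    and char: "\<And>n. n < 4 \<Longrightarrow> char_transform K h w n f = char_transform K h w n g"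
    and rep: "rep_transform K h w f = rep_transform K h w g"
    and d: "d \<in> carrier D8"
  shows "slice f d = slice g d"
proof -
  interpret K: domain K by fact
  have fg: "f \<in> carrier C3D8 \<rightarrow> carrier R" "g \<in> carrier C3D8 \<rightarrow> carrier R"
    using f g unfolding carrier_group_algebra by auto
  have "(\<Oplus>\<^bsub>K\<^esub>x\<in>carrier D8. slice f x \<otimes>\<^bsub>K\<^esub> \<guillemotleft>d8_rep a b x\<guillemotright>\<^bsub>K\<^esub>) =
      (\<Oplus>\<^bsub>K\<^esub>x\<in>carrier D8. slice g x \<otimes>\<^bsub>K\<^esub> \<guillemotleft>d8_rep a b x\<guillemotright>\<^bsub>K\<^esub>)" if "a < 2" "b < 2" for a b
    using arg_cong[OF rep, of "\<lambda>A. A $$ (a, b)"] that fg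
    by (simp add: rep_transform_def weighted_sum_twist)
  then show ?thesis
    using assms(2) slice_closed[OF fg(1)] slice_closed[OF fg(2)] char d fg
    by (intro K.d8_transform_inj[where F = "slice f" and F' = "slice g"])
      (auto simp: char_transform_def weighted_sum_twist)
qed

end

lemma group_algebra_C3D8_eqI:
  assumes "f \<in> carrier (group_algebra R C3D8)" "g \<in> carrier (group_algebra R C3D8)"
    and "\<And>d. d \<in> carrier D8 \<Longrightarrow> f (0, d) = g (0, d) \<and> f (1, d) = g (1, d) \<and> f (2, d) = g (2, d)"
  shows "f = g"
proof (rule PiE_ext)
  show "f \<in> carrier C3D8 \<rightarrow>\<^sub>E carrier R" "g \<in> carrier C3D8 \<rightarrow>\<^sub>E carrier R"
    using assms(1,2) by (simp_all only: carrier_group_algebra)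
  fix x assume "x \<in> carrier C3D8"
  then show "f x = g x" using assms(3) by (cases x) (auto simp: carrier_C3)
qed

section \<open>Decomposition of the unit group\<close>

lemma isoI_card:
  assumes "h \<in> hom M N" "inj_on h (carrier M)" "finite (carrier N)"
    and "card (carrier N) \<le> card (carrier M)"
  shows "h \<in> iso M N"
proof -
  have sub: "h ` carrier M \<subseteq> carrier N" using assms(1) by (auto simp: hom_def)
  have "h ` carrier M = carrier N"
    using assms(2-4) sub by (intro card_seteq) (auto simp: card_image)
  then show ?thesis using assms(1,2) by (simp add: iso_def bij_betw_def)
qed

lemma carrier_group_power: "carrier (group_power H n) = {..<n} \<rightarrow>\<^sub>E carrier H"
  by (simp add: group_power_def)

lemma group_power_hom:
  assumes "\<And>i. i < n \<Longrightarrow> \<phi> i \<in> hom M H"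
  shows "(\<lambda>x. \<lambda>i\<in>{..<n}. \<phi> i x) \<in> hom M (group_power H n)"
proof (rule homI)
  fix x y assume "x \<in> carrier M" "y \<in> carrier M"
  then show "(\<lambda>i\<in>{..<n}. \<phi> i (x \<otimes>\<^bsub>M\<^esub> y)) =
      (\<lambda>i\<in>{..<n}. \<phi> i x) \<otimes>\<^bsub>group_power H n\<^esub> (\<lambda>i\<in>{..<n}. \<phi> i y)"
    by (auto simp: group_power_def hom_mult[OF assms] intro!: restrict_ext)
qed (use assms in \<open>auto simp: carrier_group_power hom_def\<close>)

lemma finite_card_group_power:
  assumes "finite (carrier H)"
  shows "finite (carrier (group_power H n))" "card (carrier (group_power H n)) = card (carrier H) ^ n"
  using assms by (simp_all add: carrier_group_power finite_PiE card_PiE)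

text \<open>The n-th power of 1 in the additive group is the ring integer n, so this is the usual
  divisibility criterion for the order of an element.\<close>

lemma (in ring) of_int_eq_zero_iff: "\<guillemotleft>int n\<guillemotright> = \<zero> \<longleftrightarrow> ring_characteristic R dvd n"
proof -
  have "\<one> [^]\<^bsub>add_monoid R\<^esub> n = \<guillemotleft>int n\<guillemotright>"
    by (induction n) (simp_all add: of_int_add[of 1, simplified] a_comm)
  then show ?thesis
    using group.pow_eq_id[OF a_group, of \<one> n] by (simp add: ring_characteristic_def)
qed

lemma of_int_hom:
  assumes "ring R" "ring K" "h \<in> Ring.ring_hom R K"
  shows "h \<guillemotleft>i\<guillemotright>\<^bsub>R\<^esub> = \<guillemotleft>i\<guillemotright>\<^bsub>K\<^esub>"
proof -
  interpret R: ring R by fact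
  interpret K: ring K by fact
  interpret ring_hom_ring R K h
    using assms by (rule ring_hom_ringI2)
  have "h \<guillemotleft>n\<guillemotright>\<^sub>\<nat>\<^bsub>R\<^esub> = \<guillemotleft>n\<guillemotright>\<^sub>\<nat>\<^bsub>K\<^esub>" for n
    by (induction n) simp_all
  then show ?thesis by (simp add: of_integer_def)
qed

lemma cube_root_twistI:
  assumes "field R" "field K" "h \<in> Ring.ring_hom R K"
    and "w \<in> carrier K" "w [^]\<^bsub>K\<^esub> (3::nat) = \<one>\<^bsub>K\<^esub>"
  shows "cube_root_twist R K h w"
proof -
  interpret R: field R by fact
  interpret K: field K by fact
  interpret G: group C3D8 by (rule group_C3D8)
  show ?thesis using assms(3-5) finite_C3D8 by unfold_locales auto
qed

section \<open>The isomorphisms in the split and the quadratic case\<close>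

lemma units_of_group_algebra_C3D8_split:
  assumes F: "field F" and fin: "finite (carrier F)" and q: "3 dvd card (carrier F) - 1"
    and two: "\<guillemotleft>2\<guillemotright>\<^bsub>F\<^esub> \<noteq> \<zero>\<^bsub>F\<^esub>" and three: "\<guillemotleft>3\<guillemotright>\<^bsub>F\<^esub> \<noteq> \<zero>\<^bsub>F\<^esub>"
  shows "units_of (group_algebra F C3D8) \<cong> group_power (units_of F) 12 \<times>\<times> group_power (GL 2 F) 3"
proof -
  interpret F: field F by fact
  obtain w where w: "w \<in> carrier F" "w \<noteq> \<one>\<^bsub>F\<^esub>" "w [^]\<^bsub>F\<^esub> (3::nat) = \<one>\<^bsub>F\<^esub>"
    using F.exists_primitive_cube_root[OF fin q] by auto
  \<comment> \<open>The three cube roots of unity are \<open>r 0\<close>, \<open>r 1\<close>,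
    \<open>r 2\<close>; the cube of \<open>r i\<close> is 1 for every \<open>i\<close>, so
    \<open>tw\<close> holds without a bound.\<close>
  define r where "r i = w [^]\<^bsub>F\<^esub> (i :: nat)" for i
  have "(w [^]\<^bsub>F\<^esub> i) [^]\<^bsub>F\<^esub> (3::nat) = \<one>\<^bsub>F\<^esub>" for i :: nat
    using w(1,3) by (metis F.nat_pow_pow F.nat_pow_one mult.commute)
  then have r: "r i \<in> carrier F" "r i [^]\<^bsub>F\<^esub> (3::nat) = \<one>\<^bsub>F\<^esub>" for i
    using w(1) by (simp_all add: r_def)
  have id_hom: "(\<lambda>x. x) \<in> Ring.ring_hom F F" by (auto simp: Ring.ring_hom_def)
  have tw: "cube_root_twist F F (\<lambda>x. x) (r i)" for i
    using F F id_hom r by (rule cube_root_twistI)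
  let ?A = "group_algebra F C3D8"
  let ?T = "group_power F 12 \<times>\<times> group_power (matrix_ring 2 F) 3"
  \<comment> \<open>The 12 scalar factors are pairs of a root and a character, encoded as 4 * root +
    character.\<close>
  define \<Phi> where "\<Phi> f = (\<lambda>i\<in>{..<12}. char_transform F (\<lambda>x. x) (r (i div 4)) (i mod 4) f,
    \<lambda>i\<in>{..<3}. rep_transform F (\<lambda>x. x) (r i) f)" for f
  have hom: "\<Phi> \<in> hom ?A ?T"
    unfolding \<Phi>_def hom_paired
    by (intro conjI group_power_hom cube_root_twist.char_transform_hom[OF tw]
        cube_root_twist.rep_transform_hom[OF tw])
  have one: "\<Phi> \<one>\<^bsub>?A\<^esub> = \<one>\<^bsub>?T\<^esub>"
    by (simp add: \<Phi>_def cube_root_twist.char_transform_one[OF tw]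
        cube_root_twist.rep_transform_one[OF tw] group_power_def)
  have inj: "inj_on \<Phi> (carrier ?A)"
  proof (rule inj_onI)
    fix f g assume f: "f \<in> carrier ?A" and g: "g \<in> carrier ?A" and eq: "\<Phi> f = \<Phi> g"
    have char: "char_transform F (\<lambda>x. x) (r i) n f = char_transform F (\<lambda>x. x) (r i) n g"
      if "i < 3" "n < 4" for i n
      using arg_cong[OF eq, of "\<lambda>p. fst p (4 * i + n)"] that by (simp add: \<Phi>_def)
    have rep: "rep_transform F (\<lambda>x. x) (r i) f = rep_transform F (\<lambda>x. x) (r i) g" if "i < 3" for i
      using arg_cong[OF eq, of "\<lambda>p. snd p i"] that by (simp add: \<Phi>_def)
    have slice: "cube_root_twist.slice F (\<lambda>x. x) (r i) f d = cube_root_twist.slice F (\<lambda>x. x) (r i) g d"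
      if "i < 3" "d \<in> carrier D8" for i d
      using F.domain_axioms two f g char[OF that(1)] rep[OF that(1)] that(2)
      by (rule cube_root_twist.slice_eqI[OF tw])
    show "f = g"
    proof (rule group_algebra_C3D8_eqI[OF f g])
      fix d assume d: "d \<in> carrier D8"
      have c: "f (0, d) \<in> carrier F" "f (1, d) \<in> carrier F" "f (2, d) \<in> carrier F"
        "g (0, d) \<in> carrier F" "g (1, d) \<in> carrier F" "g (2, d) \<in> carrier F"
        using f g d by (auto simp: carrier_group_algebra carrier_C3)
      note cube = F.cube_root_of_unity[OF w]
      have r012: "r 0 = \<one>\<^bsub>F\<^esub>" "r 1 = w" "r 2 = w \<otimes>\<^bsub>F\<^esub> w"
        using w(1) by (simp_all add: r_def numeral_2_eq_2)
      \<comment> \<open>The slice for the root w^2 contains its square w^4, which has to be reduced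
        to w to match the third equation of the C3 inversion.\<close>
      have ww: "w \<otimes>\<^bsub>F\<^esub> w \<otimes>\<^bsub>F\<^esub> (w \<otimes>\<^bsub>F\<^esub> w) = w"
        using w(1) cube(1) by (metis F.m_assoc F.m_closed F.l_one)
      note s = slice[OF _ d, unfolded cube_root_twist.slice_def[OF tw]]
      show "f (0, d) = g (0, d) \<and> f (1, d) = g (1, d) \<and> f (2, d) = g (2, d)"
        using s[of 0] s[of 1] s[of 2] c w(1) unfolding r012 ww
        by (intro F.cube_root_transform_inj[OF w(1) _ refl cube three c]) simp_all
    qed
  qed
  have card_A: "card (carrier ?A) = card (carrier F) ^ 24"
    using finite_C3D8 card_C3D8 by (simp only: carrier_group_algebra card_PiE prod_constant)
  note M = finite_carrier_matrix_ring[OF fin, of 2]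
  have "card (carrier ?T) = card (carrier F) ^ 12 * card (carrier (matrix_ring 2 F)) ^ 3"
    by (simp add: card_cartesian_product finite_card_group_power fin M(1))
  also have "\<dots> \<le> card (carrier F) ^ 12 * (card (carrier F) ^ 4) ^ 3"
    using M(2) by (intro mult_le_mono power_mono) simp_all
  \<comment> \<open>The exponents of q add up: 12 + 4 * 3 = 24.\<close>
  also have "\<dots> = card (carrier ?A)" by (simp add: card_A flip: power_mult power_add)
  finally have "\<Phi> \<in> iso ?A ?T"
    using hom inj fin M(1) by (intro isoI_card) (simp_all add: finite_card_group_power)
  then have "units_of ?A \<cong> units_of ?T"
    using one_group_algebra_closed[OF F.ring_axioms] one
      mult_group_algebra_closed[OF F.ring_axioms group_C3D8] by (rule is_iso_units_ofI)
  then show ?thesis by (simp add: units_of_DirProd units_of_group_power GL_def)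
qed

text \<open>F C3 embeds into F x K by sending a generator to (1, w), and the dimensions 1 + 2 over F
  match. Each representation of D8 thus contributes one factor over F and one over K.\<close>

lemma units_of_group_algebra_C3D8_nonsplit:
  assumes F: "field F" and fin: "finite (carrier F)" and K: "field K" "finite (carrier K)"
    and h: "h \<in> Ring.ring_hom F K" and card_K: "card (carrier K) = card (carrier F) ^ 2"
    and w: "w \<in> carrier K" "w \<notin> h ` carrier F" "w [^]\<^bsub>K\<^esub> (3::nat) = \<one>\<^bsub>K\<^esub>"
    and two: "\<guillemotleft>2\<guillemotright>\<^bsub>F\<^esub> \<noteq> \<zero>\<^bsub>F\<^esub>" and three: "\<guillemotleft>3\<guillemotright>\<^bsub>F\<^esub> \<noteq> \<zero>\<^bsub>F\<^esub>"
  shows "units_of (group_algebra F C3D8) \<cong>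
    group_power (units_of F) 4 \<times>\<times> group_power (units_of K) 4 \<times>\<times> GL 2 F \<times>\<times> GL 2 K"
proof -
  interpret F: field F by fact
  interpret K: field K by fact
  have id_hom: "(\<lambda>x. x) \<in> Ring.ring_hom F F" by (auto simp: Ring.ring_hom_def)
  have tw1: "cube_root_twist F F (\<lambda>x. x) \<one>\<^bsub>F\<^esub>"
    using F F id_hom by (rule cube_root_twistI) simp_all
  have tw2: "cube_root_twist F K h w"
    using F K(1) h w(1,3) by (rule cube_root_twistI)
  \<comment> \<open>The D8 inversion for the second root takes place in K, so 2 has to be nonzero
    there as well.\<close>
  have "h \<guillemotleft>2\<guillemotright>\<^bsub>F\<^esub> \<noteq> h \<zero>\<^bsub>F\<^esub>"
    using two inj_on_eq_iff[OF field_hom_inj[OF F K(1) h]] by simp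
  then have two_K: "\<guillemotleft>2\<guillemotright>\<^bsub>K\<^esub> \<noteq> \<zero>\<^bsub>K\<^esub>"
    using of_int_hom[OF F.ring_axioms K.ring_axioms h, of 2]
      of_int_hom[OF F.ring_axioms K.ring_axioms h, of 0] by simp
  have "w \<noteq> \<one>\<^bsub>K\<^esub>" using w(2) ring_hom_one[OF h] F.one_closed by (metis imageI)
  note cube = K.cube_root_of_unity[OF w(1) this w(3)]
  let ?A = "group_algebra F C3D8"
  let ?T = "group_power F 4 \<times>\<times> group_power K 4 \<times>\<times> matrix_ring 2 F \<times>\<times> matrix_ring 2 K"
  define \<Phi> where "\<Phi> f = (\<lambda>i\<in>{..<4}. char_transform F (\<lambda>x. x) \<one>\<^bsub>F\<^esub> i f,
    \<lambda>i\<in>{..<4}. char_transform K h w i f, rep_transform F (\<lambda>x. x) \<one>\<^bsub>F\<^esub> f, rep_transform K h w f)" for f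
  have hom: "\<Phi> \<in> hom ?A ?T"
    unfolding \<Phi>_def hom_paired
    by (intro conjI group_power_hom cube_root_twist.char_transform_hom[OF tw1]
        cube_root_twist.rep_transform_hom[OF tw1] cube_root_twist.char_transform_hom[OF tw2]
        cube_root_twist.rep_transform_hom[OF tw2])
  have one: "\<Phi> \<one>\<^bsub>?A\<^esub> = \<one>\<^bsub>?T\<^esub>"
    by (simp add: \<Phi>_def cube_root_twist.char_transform_one[OF tw1]
        cube_root_twist.rep_transform_one[OF tw1] cube_root_twist.char_transform_one[OF tw2]
        cube_root_twist.rep_transform_one[OF tw2] group_power_def)
  have inj: "inj_on \<Phi> (carrier ?A)"
  proof (rule inj_onI)
    fix f g assume f: "f \<in> carrier ?A" and g: "g \<in> carrier ?A" and eq: "\<Phi> f = \<Phi> g"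
    have char1: "char_transform F (\<lambda>x. x) \<one>\<^bsub>F\<^esub> n f = char_transform F (\<lambda>x. x) \<one>\<^bsub>F\<^esub> n g" if "n < 4" for n
      using arg_cong[OF eq, of "\<lambda>p. fst p n"] that by (simp add: \<Phi>_def)
    have char2: "char_transform K h w n f = char_transform K h w n g" if "n < 4" for n
      using arg_cong[OF eq, of "\<lambda>p. fst (snd p) n"] that by (simp add: \<Phi>_def)
    have rep1: "rep_transform F (\<lambda>x. x) \<one>\<^bsub>F\<^esub> f = rep_transform F (\<lambda>x. x) \<one>\<^bsub>F\<^esub> g"
      and rep2: "rep_transform K h w f = rep_transform K h w g"
      using eq by (simp_all add: \<Phi>_def)
    show "f = g"
    proof (rule group_algebra_C3D8_eqI[OF f g])
      fix d assume d: "d \<in> carrier D8"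
      have c: "f (0, d) \<in> carrier F" "f (1, d) \<in> carrier F" "f (2, d) \<in> carrier F"
        "g (0, d) \<in> carrier F" "g (1, d) \<in> carrier F" "g (2, d) \<in> carrier F"
        using f g d by (auto simp: carrier_group_algebra carrier_C3)
      have "cube_root_twist.slice F (\<lambda>x. x) \<one>\<^bsub>F\<^esub> f d = cube_root_twist.slice F (\<lambda>x. x) \<one>\<^bsub>F\<^esub> g d"
        using F.domain_axioms two f g char1 rep1 d by (rule cube_root_twist.slice_eqI[OF tw1])
      then have e1: "f (0, d) \<oplus>\<^bsub>F\<^esub> f (1, d) \<oplus>\<^bsub>F\<^esub> f (2, d) = g (0, d) \<oplus>\<^bsub>F\<^esub> g (1, d) \<oplus>\<^bsub>F\<^esub> g (2, d)"
        using c unfolding cube_root_twist.slice_def[OF tw1] by simp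
      have e2: "cube_root_twist.slice K h w f d = cube_root_twist.slice K h w g d"
        using K.domain_axioms two_K f g char2 rep2 d by (rule cube_root_twist.slice_eqI[OF tw2])
      show "f (0, d) = g (0, d) \<and> f (1, d) = g (1, d) \<and> f (2, d) = g (2, d)"
        using e2 unfolding cube_root_twist.slice_def[OF tw2]
        by (rule quadratic_transform_inj[OF F K(1) h three w(1,2) cube(2) c e1])
    qed
  qed
  have card_A: "card (carrier ?A) = card (carrier F) ^ 24"
    using finite_C3D8 card_C3D8 by (simp only: carrier_group_algebra card_PiE prod_constant)
  note M1 = finite_carrier_matrix_ring[OF fin, of 2]
  note M2 = finite_carrier_matrix_ring[OF K(2), of 2]
  have "card (carrier ?T) = card (carrier F) ^ 4 * (card (carrier K) ^ 4 *
      (card (carrier (matrix_ring 2 F)) * card (carrier (matrix_ring 2 K))))"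
    by (simp add: card_cartesian_product finite_card_group_power fin K(2))
  also have "\<dots> \<le> card (carrier F) ^ 4 * (card (carrier K) ^ 4 *
      (card (carrier F) ^ 4 * card (carrier K) ^ 4))"
    using M1(2) M2(2) by (intro mult_le_mono) simp_all
  \<comment> \<open>Since |K| = q^2, the exponents of q are 4 + 8 + 4 + 8 = 24.\<close>
  also have "\<dots> = card (carrier ?A)" by (simp add: card_A card_K flip: power_mult power_add)
  finally have "\<Phi> \<in> iso ?A ?T"
    using hom inj fin K(2) M1(1) M2(1) by (intro isoI_card) (simp_all add: finite_card_group_power)
  then have "units_of ?A \<cong> units_of ?T"
    using one_group_algebra_closed[OF F.ring_axioms] one
      mult_group_algebra_closed[OF F.ring_axioms group_C3D8] by (rule is_iso_units_ofI)
  then show ?thesis by (simp add: units_of_DirProd units_of_group_power GL_def)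
qed

theorem theorem2p10:
  fixes F :: "('a, 'm) ring_scheme" and F2 :: "('b, 'n) ring_scheme"
    and p k q :: nat
  assumes "field F" and "finite (carrier F)"
    and "ring_characteristic F = p"
    and "card (carrier F) = q" and "q = p ^ k"
    and "p > 3"
  shows
    "([int q = 1] (mod 12) \<or> [int q = -5] (mod 12) \<longrightarrow>
        units_of (group_algebra F (integer_mod_group 3 \<times>\<times> dihedral_group 8)) \<cong>
          group_power (integer_mod_group (p ^ k - 1)) 12 \<times>\<times> group_power (GL 2 F) 3)
     \<and>
     ([int q = -1] (mod 12) \<or> [int q = 5] (mod 12) \<longrightarrow>
        extension_field_of_degree 2 F F2 \<longrightarrow>
        units_of (group_algebra F (integer_mod_group 3 \<times>\<times> dihedral_group 8)) \<cong>
          group_power (integer_mod_group (p ^ k - 1)) 4 \<times>\<times>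
          group_power (integer_mod_group (p ^ (2 * k) - 1)) 4 \<times>\<times>
          GL 2 F \<times>\<times> GL 2 F2)"
proof (intro conjI impI)
  interpret F: field F by fact
  \<comment> \<open>A number p > 3 divides neither 2 nor 3, as both are positive and
    smaller.\<close>
  have two: "\<guillemotleft>2\<guillemotright>\<^bsub>F\<^esub> \<noteq> \<zero>\<^bsub>F\<^esub>" and three: "\<guillemotleft>3\<guillemotright>\<^bsub>F\<^esub> \<noteq> \<zero>\<^bsub>F\<^esub>"
    using F.of_int_eq_zero_iff[of 2] F.of_int_eq_zero_iff[of 3] assms(3,6)
    by (auto dest: dvd_imp_le)
  have units_F: "group_power (units_of F) n \<cong> group_power (integer_mod_group (p ^ k - 1)) n" for n
    using F.units_of_iso_integer_mod_group[OF assms(2)] assms(4,5) F.units_group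
    by (intro is_iso_group_power) simp_all
  {
    assume "[int q = 1] (mod 12) \<or> [int q = -5] (mod 12)"
    then have "int q mod 12 = 1 \<or> int q mod 12 = 7" by (simp add: cong_def)
    then have "3 dvd q - 1" by presburger
    then have "units_of (group_algebra F C3D8) \<cong> group_power (units_of F) 12 \<times>\<times> group_power (GL 2 F) 3"
      using assms(1,2,4) two three by (intro units_of_group_algebra_C3D8_split) simp_all
    also have "\<dots> \<cong> group_power (integer_mod_group (p ^ k - 1)) 12 \<times>\<times> group_power (GL 2 F) 3"
      using units_F iso_refl by (rule is_iso_DirProd)
    finally show "units_of (group_algebra F C3D8) \<cong>
      group_power (integer_mod_group (p ^ k - 1)) 12 \<times>\<times> group_power (GL 2 F) 3" .
  next
    assume "[int q = -1] (mod 12) \<or> [int q = 5] (mod 12)" and ext: "extension_field_of_degree 2 F F2"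
    then have "int q mod 12 = 11 \<or> int q mod 12 = 5" by (simp add: cong_def)
    \<comment> \<open>This form serves twice: 3 divides q^2 - 1, so the extension has a primitive
      cube root of unity, while q - 1 = 3 m + 1 keeps it out of F.\<close>
    then have "\<exists>m. q = 3 * m + 2" by presburger
    then obtain m where m: "q = 3 * m + 2" by blast
    obtain h where F2: "field F2" and h: "h \<in> Ring.ring_hom F F2"
      and dim: "ring.dimension F2 2 (h ` carrier F) (carrier F2)"
      using ext by (auto simp: extension_field_of_degree_def)
    interpret F2: field F2 by fact
    interpret h: ring_hom_ring F F2 h
      using F.ring_axioms F2.ring_axioms h by (rule ring_hom_ringI2)
    have inj: "inj_on h (carrier F)" using assms(1) F2 h by (rule field_hom_inj)
    have "subfield (h ` carrier F) F2"
      using F.carrier_is_subfield F2.one_not_zero by (rule h.img_is_subfield(2))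
    then have card_F2: "card (carrier F2) = q ^ 2"
      using F2.card_dimension[OF _ dim] card_image[OF inj] assms(4) by simp
    \<comment> \<open>An infinite set has \<open>card\<close> 0, whereas q^2 is positive because q =
      3 m + 2.\<close>
    then have fin_F2: "finite (carrier F2)" using m by (intro card_ge_0_finite) simp
    have "q ^ 2 - 1 = 3 * (3 * m ^ 2 + 4 * m + 1)"
      by (simp add: m power2_eq_square algebra_simps)
    then obtain w where w: "w \<in> carrier F2" "w \<noteq> \<one>\<^bsub>F2\<^esub>" "w [^]\<^bsub>F2\<^esub> (3::nat) = \<one>\<^bsub>F2\<^esub>"
      using F2.exists_primitive_cube_root[OF fin_F2] card_F2 by auto
    have w_notin: "w \<notin> h ` carrier F"
    proof
      assume "w \<in> h ` carrier F"
      then obtain x where x: "x \<in> carrier F" "w = h x" by auto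
      \<comment> \<open>Otherwise w = 0, contradicting w^3 = 1.\<close>
      have "x \<noteq> \<zero>\<^bsub>F\<^esub>"
        using w x by (metis F2.nat_pow_zero h.hom_zero zero_neq_numeral)
      then have "x [^]\<^bsub>F\<^esub> (3 * m + 1) = \<one>\<^bsub>F\<^esub>"
        using F.units_power_order_eq_one[of x] F.card_Units[OF assms(2)] assms(2,4) x(1) m
        by (simp add: F.field_Units)
      moreover have "h (x [^]\<^bsub>F\<^esub> n) = w [^]\<^bsub>F2\<^esub> n" for n :: nat
        unfolding x(2) by (induction n) (simp_all add: x(1))
      ultimately have "w [^]\<^bsub>F2\<^esub> (3 * m + 1) = \<one>\<^bsub>F2\<^esub>"
        using h.hom_one by metis
      \<comment> \<open>As w^3 = 1, the exponent q - 1 acts on w like the exponent 1, so w coming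
        from F would force w = 1.\<close>
      moreover have "w [^]\<^bsub>F2\<^esub> (3 * m + 1) = w"
        using w by (simp flip: F2.nat_pow_mult F2.nat_pow_pow)
      ultimately show False using w(2) by simp
    qed
    have units_F2: "group_power (units_of F2) n \<cong> group_power (integer_mod_group (p ^ (2 * k) - 1)) n" for n
      using F2.units_of_iso_integer_mod_group[OF fin_F2] card_F2 assms(5) F2.units_group
      by (intro is_iso_group_power) (simp_all add: power_mult mult.commute[of 2] )
    have "units_of (group_algebra F C3D8) \<cong>
      group_power (units_of F) 4 \<times>\<times> group_power (units_of F2) 4 \<times>\<times> GL 2 F \<times>\<times> GL 2 F2"
      using assms(1,2,4) F2 fin_F2 h card_F2 w w_notin two three
      by (intro units_of_group_algebra_C3D8_nonsplit[of F F2 h w]) simp_all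
    also have "\<dots> \<cong> group_power (integer_mod_group (p ^ k - 1)) 4 \<times>\<times>
        group_power (integer_mod_group (p ^ (2 * k) - 1)) 4 \<times>\<times> GL 2 F \<times>\<times> GL 2 F2"
      by (intro is_iso_DirProd units_F units_F2 iso_refl)
    finally show "units_of (group_algebra F C3D8) \<cong>
      group_power (integer_mod_group (p ^ k - 1)) 4 \<times>\<times>
        group_power (integer_mod_group (p ^ (2 * k) - 1)) 4 \<times>\<times> GL 2 F \<times>\<times> GL 2 F2" .
  }
qed

end
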